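(* A generic element $\mathcal G\in ISU(2)$ can be written as $$\mathcal G=\exp\big[i(\Theta^aJ^a+X^aP^a)\big],$$ with real parameters $\Theta=(\Theta^1,\Theta^2,\Theta^3)$ and $X=(X^1,X^2,X^3)$, in which $0\le|\Theta|<2\pi$ whereas there are no restrictions on the value of $X$. The conjugacy classes of $ISU(2)$ can be labelled by two real numbers $(r_1,r_2)$, with $r_1=|\Theta|$ and $$r_2=\begin{cases}|X| & \text{when } r_1=0,\\ \Theta\cdot X=\Theta^aX^a & \text{when } r_1\neq0.\end{cases}$$ The set of variables $\{(r_1,r_2)\}$ does not parametrize a two-dimensional manifold, because of the singularity at $r_1=0$.
   Context: $ISU(2)$ is the inhomogeneous group of $SU(2)$, with Lie algebra generators $J^a,P^a$, $a=1,2,3$, satisfying $[J^a,J^b]=i\epsilon^{abc}J^c$, $[J^a,P^b]=i\epsilon^{abc}P^c$, $[P^a,P^b]=0$; the $J^a$ generate the $SU(2)$ subgroup and the $P^a$ generate the translations. Repeated indices are summed.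
   Formalization: The labelling is stated for the conjugacy classes of elements exp[i(Θ·J+X·P)] with |Θ|<2π; the classes whose SU(2) part is −1 (for example that of −1 itself) are left out, since they have no such Θ and hence no label (r1,r2). *)

theory Defs
  imports "HOL-Analysis.Analysis" "HOL-Algebra.Group_Action"
begin

subsection \<open>Matrices\<close>

definition cscale :: "complex \<Rightarrow> complex^'n^'m \<Rightarrow> complex^'n^'m" where
  "cscale c A = map_matrix ((*) c) A"

definition cadjoint :: "complex^'n^'m \<Rightarrow> complex^'m^'n" where
  "cadjoint A = transpose (map_matrix cnj A)"

primrec matpow :: "complex^'n^'n \<Rightarrow> nat \<Rightarrow> complex^'n^'n" where
  "matpow A 0 = mat 1"
| "matpow A (Suc n) = A ** matpow A n"

text \<open>The library product \<open>*\<close> on \<^typ>\<open>complex^'n^'n\<close> is componentwise, so neither its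
  powers nor its \<^const>\<open>exp\<close> are the ones needed here.\<close>

definition mexp :: "complex^'n^'n \<Rightarrow> complex^'n^'n" where
  "mexp A = (\<Sum>n. (1 / fact n) *\<^sub>R matpow A n)"

definition commutator :: "complex^'n^'n \<Rightarrow> complex^'n^'n \<Rightarrow> complex^'n^'n" where
  "commutator A B = A ** B - B ** A"

text \<open>The matrix with rows \<open>(A B)\<close> and \<open>(C D)\<close> of blocks; the index type is a disjoint sum.\<close>

definition block ::
  "complex^'n^'n \<Rightarrow> complex^'n^'n \<Rightarrow> complex^'n^'n \<Rightarrow> complex^'n^'n \<Rightarrow> complex^('n+'n)^('n+'n)" where
  "block A B C D = (\<chi> i j. case i of
      Inl a \<Rightarrow> (case j of Inl b \<Rightarrow> A $ a $ b | Inr b \<Rightarrow> B $ a $ b)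
    | Inr a \<Rightarrow> (case j of Inl b \<Rightarrow> C $ a $ b | Inr b \<Rightarrow> D $ a $ b))"


subsection \<open>The group ISU(2) and its generators\<close>

definition pauli :: "3 \<Rightarrow> complex^2^2" where
  "pauli a = (if a = 1 then vector [vector [0, 1], vector [1, 0]]
    else if a = 2 then vector [vector [0, - \<i>], vector [\<i>, 0]]
    else vector [vector [1, 0], vector [0, -1]])"

definition spin :: "real^3 \<Rightarrow> complex^2^2" where
  "spin x = (\<Sum>a\<in>UNIV. (x $ a / 2) *\<^sub>R pauli a)"

definition SU2 :: "(complex^2^2) set" where
  "SU2 = {u. u ** cadjoint u = mat 1 \<and> cadjoint u ** u = mat 1 \<and> det u = 1}"

type_synonym isu2_mat = "complex^(2+2)^(2+2)"

text \<open>ISU(2) is the semidirect product of SU(2) with the translation group \<open>\<real>\<^sup>3\<close>, on which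
  \<open>u \<in> SU(2)\<close> acts by the rotation \<open>spin x \<mapsto> u (spin x) u\<^sup>\<dagger>\<close>. It is realised faithfully by block
  matrices; see \<open>isu2_elem_mult\<close>, \<open>isu2_elem_inject\<close> below. Its topology is that of the ambient
  matrix space.\<close>

definition translation :: "real^3 \<Rightarrow> isu2_mat" where
  "translation x = block (mat 1) (cscale \<i> (spin x)) 0 (mat 1)"

definition rotation :: "complex^2^2 \<Rightarrow> isu2_mat" where
  "rotation u = block u 0 0 u"

definition ISU2 :: "isu2_mat monoid" where
  "ISU2 = \<lparr>carrier = {translation x ** rotation u | x u. u \<in> SU2}, mult = (**), one = mat 1\<rparr>"

definition isu2_J :: "3 \<Rightarrow> isu2_mat" where
  "isu2_J a = block ((1/2) *\<^sub>R pauli a) 0 0 ((1/2) *\<^sub>R pauli a)"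

definition isu2_P :: "3 \<Rightarrow> isu2_mat" where
  "isu2_P a = block 0 ((1/2) *\<^sub>R pauli a) 0 0"

definition isu2_exp :: "real^3 \<Rightarrow> real^3 \<Rightarrow> isu2_mat" where
  "isu2_exp \<Theta> X = mexp (cscale \<i> (\<Sum>a\<in>UNIV. (\<Theta> $ a) *\<^sub>R isu2_J a + (X $ a) *\<^sub>R isu2_P a))"

text \<open>The elements whose SU(2) part is \<open>-1\<close> correspond to the excluded value \<open>|\<Theta>| = 2 pi\<close>.\<close>

definition ISU2_generic :: "isu2_mat set" where
  "ISU2_generic = {translation x ** rotation u | x u. u \<in> SU2 \<and> u \<noteq> - mat 1}"

definition levi_civita :: "3 \<Rightarrow> 3 \<Rightarrow> 3 \<Rightarrow> real" where
  "levi_civita a b c = det (vector [axis a 1, axis b 1, axis c 1] :: real^3^3)"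


subsection \<open>Conjugacy classes and their labels\<close>

definition conjugacy_class :: "('a, 'b) monoid_scheme \<Rightarrow> 'a \<Rightarrow> 'a set" where
  "conjugacy_class G x =
     orbit G (\<lambda>h. \<lambda>y\<in>carrier G. h \<otimes>\<^bsub>G\<^esub> y \<otimes>\<^bsub>G\<^esub> inv\<^bsub>G\<^esub> h) x"

definition generic_classes :: "isu2_mat set set" where
  "generic_classes = conjugacy_class ISU2 ` ISU2_generic"

definition r1 :: "real^3 \<Rightarrow> real" where
  "r1 \<Theta> = norm \<Theta>"

definition r2 :: "real^3 \<Rightarrow> real^3 \<Rightarrow> real" where
  "r2 \<Theta> X = (if r1 \<Theta> = 0 then norm X else \<Theta> \<bullet> X)"

definition labels :: "(real \<times> real) set" where
  "labels = {(r1 \<Theta>, r2 \<Theta> X) | \<Theta> X. norm \<Theta> < 2 * pi}"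


subsection \<open>Topological surfaces\<close>

definition quotient_topology :: "'a topology \<Rightarrow> ('a \<Rightarrow> 'b) \<Rightarrow> 'b topology" where
  "quotient_topology X f =
     topology (\<lambda>V. V \<subseteq> f ` topspace X \<and> openin X {x \<in> topspace X. f x \<in> V})"

definition class_space :: "isu2_mat set topology" where
  "class_space = quotient_topology (top_of_set ISU2_generic) (conjugacy_class ISU2)"

definition locally_planar_at :: "'a topology \<Rightarrow> 'a \<Rightarrow> bool" where
  "locally_planar_at X p \<longleftrightarrow> (\<exists>U (V :: (real^2) set). openin X U \<and> p \<in> U \<and> open V \<and>
     subtopology X U homeomorphic_space top_of_set V)"

definition two_manifold :: "'a topology \<Rightarrow> bool" where
  "two_manifold X \<longleftrightarrow> Hausdorff_space X \<and>
     (\<exists>\<B>. countable \<B> \<and> (\<forall>B\<in>\<B>. openin X B) \<and>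
        (\<forall>U p. openin X U \<and> p \<in> U \<longrightarrow> (\<exists>B\<in>\<B>. p \<in> B \<and> B \<subseteq> U))) \<and>
     (\<forall>p\<in>topspace X. locally_planar_at X p)"


subsection \<open>Sanity checks\<close>

lemma istopology_quotient:
  "istopology (\<lambda>V. V \<subseteq> f ` topspace X \<and> openin X {x \<in> topspace X. f x \<in> V})"
proof -
  have "openin X {x \<in> topspace X. f x \<in> S \<inter> T}"
    if "openin X {x \<in> topspace X. f x \<in> S}" "openin X {x \<in> topspace X. f x \<in> T}" for S T
  proof -
    have "{x \<in> topspace X. f x \<in> S \<inter> T} = {x \<in> topspace X. f x \<in> S} \<inter> {x \<in> topspace X. f x \<in> T}"
      by auto
    then show ?thesis using that by auto
  qed
  moreover have "openin X {x \<in> topspace X. f x \<in> \<Union>\<K>}"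
    if "\<forall>K\<in>\<K>. K \<subseteq> f ` topspace X \<and> openin X {x \<in> topspace X. f x \<in> K}" for \<K>
  proof -
    have "{x \<in> topspace X. f x \<in> \<Union>\<K>} = (\<Union>K\<in>\<K>. {x \<in> topspace X. f x \<in> K})"
      by auto
    then show ?thesis using that by auto
  qed
  ultimately show ?thesis
    unfolding istopology_def by (auto 0 3)
qed

lemma openin_quotient_topology:
  "openin (quotient_topology X f) V \<longleftrightarrow>
     V \<subseteq> f ` topspace X \<and> openin X {x \<in> topspace X. f x \<in> V}"
  unfolding quotient_topology_def
  by (subst topology_inverse'[OF istopology_quotient]) (rule refl)

lemma topspace_quotient_topology: "topspace (quotient_topology X f) = f ` topspace X"
proof -
  have "{x \<in> topspace X. f x \<in> f ` topspace X} = topspace X" by auto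
  then have "openin (quotient_topology X f) (f ` topspace X)"
    by (simp add: openin_quotient_topology)
  then show ?thesis
    by (metis openin_quotient_topology openin_subset openin_topspace subset_antisym)
qed

lemma quotient_map_quotient_topology: "quotient_map X (quotient_topology X f) f"
  unfolding quotient_map_def
  by (auto simp: topspace_quotient_topology openin_quotient_topology)

lemma block_mult:
  "block A B C D ** block A' B' C' D' =
     block (A ** A' + B ** C') (A ** B' + B ** D') (C ** A' + D ** C') (C ** B' + D ** D')"
proof -
  have S: "(\<Sum>k\<in>UNIV. g k) = (\<Sum>k\<in>UNIV. g (Inl k)) + (\<Sum>k\<in>UNIV. g (Inr k))"
    for g :: "'a + 'a \<Rightarrow> complex"
    by (subst UNIV_Plus_UNIV[symmetric], subst sum.Plus) auto
  show ?thesis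
    by (simp add: block_def matrix_matrix_mult_def vec_eq_iff S split: sum.split)
qed

lemma block_eq_iff:
  "block A B C D = block A' B' C' D' \<longleftrightarrow> A = A' \<and> B = B' \<and> C = C' \<and> D = D'"
proof
  assume "block A B C D = block A' B' C' D'"
  then have e: "block A B C D $ i $ j = block A' B' C' D' $ i $ j" for i j
    by simp
  from e[of "Inl _" "Inl _"] e[of "Inl _" "Inr _"] e[of "Inr _" "Inl _"] e[of "Inr _" "Inr _"]
  show "A = A' \<and> B = B' \<and> C = C' \<and> D = D'"
    by (auto simp: block_def vec_eq_iff)
qed simp

lemma mat_mult_2:
  fixes A B :: "complex^2^2"
  shows "(A ** B) $ i $ j = A $ i $ 1 * B $ 1 $ j + A $ i $ 2 * B $ 2 $ j"
  by (simp add: matrix_matrix_mult_def UNIV_2)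

lemma scaleR_complex: "r *\<^sub>R (z :: complex) = of_real r * z"
  by (rule scaleR_conv_of_real)

lemma pauli_commutator:
  "pauli a ** pauli b - pauli b ** pauli a =
     (\<Sum>c\<in>UNIV. cscale (2 * \<i> * levi_civita a b c) (pauli c))"
  using exhaust_3[of a] exhaust_3[of b]
  by (auto simp: vec_eq_iff mat_mult_2 forall_2 sum_3 pauli_def cscale_def levi_civita_def
      det_3 axis_def mult.assoc)

lemma commutation_relations:
  "commutator (isu2_J a) (isu2_J b) = (\<Sum>c\<in>UNIV. cscale (\<i> * levi_civita a b c) (isu2_J c))"
  "commutator (isu2_J a) (isu2_P b) = (\<Sum>c\<in>UNIV. cscale (\<i> * levi_civita a b c) (isu2_P c))"
  "commutator (isu2_P a) (isu2_P b) = 0"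
proof -
  have s: "(\<Sum>c\<in>UNIV. cscale (\<i> * levi_civita a b c) ((1/2) *\<^sub>R pauli c)) =
      ((1/2) *\<^sub>R pauli a) ** ((1/2) *\<^sub>R pauli b) - ((1/2) *\<^sub>R pauli b) ** ((1/2) *\<^sub>R pauli a)"
  proof -
    have "((1/2) *\<^sub>R pauli a) ** ((1/2) *\<^sub>R pauli b) - ((1/2) *\<^sub>R pauli b) ** ((1/2) *\<^sub>R pauli a)
        = (1/4) *\<^sub>R (pauli a ** pauli b - pauli b ** pauli a)"
      by (simp add: vec_eq_iff mat_mult_2 scaleR_complex field_simps)
    then show ?thesis
      unfolding pauli_commutator
      by (simp add: sum_3 vec_eq_iff cscale_def scaleR_complex field_simps)
  qed
  have [simp]: "cscale c (block A B C D) = block (cscale c A) (cscale c B) (cscale c C) (cscale c D)"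
    for c and A B C D :: "complex^2^2"
    by (auto simp: cscale_def block_def vec_eq_iff split: sum.split)
  have [simp]: "block A B C D + block A' B' C' D' = block (A+A') (B+B') (C+C') (D+D')"
    and [simp]: "block A B C D - block A' B' C' D' = block (A-A') (B-B') (C-C') (D-D')"
    for A B C D A' B' C' D' :: "complex^2^2"
    by (auto simp: block_def vec_eq_iff split: sum.split)
  have z: "cscale c (0 :: complex^2^2) = 0" for c
    by (simp add: cscale_def vec_eq_iff)
  have b0: "block 0 0 0 0 = (0 :: isu2_mat)"
    by (auto simp: block_def vec_eq_iff split: sum.split)
  show "commutator (isu2_J a) (isu2_J b) = (\<Sum>c\<in>UNIV. cscale (\<i> * levi_civita a b c) (isu2_J c))"
    using s by (simp add: commutator_def isu2_J_def block_mult sum_3 z block_eq_iff)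
  show "commutator (isu2_J a) (isu2_P b) = (\<Sum>c\<in>UNIV. cscale (\<i> * levi_civita a b c) (isu2_P c))"
    using s by (simp add: commutator_def isu2_J_def isu2_P_def block_mult sum_3 z block_eq_iff)
  show "commutator (isu2_P a) (isu2_P b) = 0"
    by (simp add: commutator_def isu2_P_def block_mult b0)
qed

lemma spin_components:
  "spin x $ 1 $ 1 = x $ 3 / 2" "spin x $ 1 $ 2 = (x $ 1 - \<i> * x $ 2) / 2"
  "spin x $ 2 $ 1 = (x $ 1 + \<i> * x $ 2) / 2" "spin x $ 2 $ 2 = - (x $ 3 / 2)"
  by (simp_all add: spin_def sum_3 pauli_def scaleR_complex field_simps)

lemma spin_inject: "spin x = spin y \<longleftrightarrow> x = y"
proof
  assume e: "spin x = spin y"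
  have "spin x $ 1 $ 1 = spin y $ 1 $ 1" "spin x $ 1 $ 2 = spin y $ 1 $ 2" using e by auto
  then show "x = y"
    by (auto simp: spin_components vec_eq_iff forall_3 complex_eq_iff)
qed simp

lemma spin_add: "spin (x + y) = spin x + spin y"
  by (simp add: spin_def scaleR_add_left sum.distrib add_divide_distrib)

lemma ex_spin:
  assumes "cadjoint M = M" "trace M = 0"
  shows "\<exists>y. spin y = M"
proof
  have h: "cnj (M $ j $ i) = M $ i $ j" for i j
    using arg_cong[OF assms(1), of "\<lambda>A. A $ i $ j"] by (simp add: cadjoint_def transpose_def)
  have t: "M $ 2 $ 2 = - M $ 1 $ 1"
    using assms(2) by (simp add: trace_def sum_2 add_eq_0_iff)
  show "spin (vector [2 * Re (M $ 1 $ 2), - 2 * Im (M $ 1 $ 2), 2 * Re (M $ 1 $ 1)]) = M"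
    using h[of 1 1] h[of 1 2] h[of 2 1] t
    by (auto simp: vec_eq_iff forall_2 spin_components complex_eq_iff)
qed

lemma cadjoint_mult: "cadjoint (A ** B) = cadjoint B ** cadjoint A"
  by (simp add: cadjoint_def transpose_def matrix_matrix_mult_def vec_eq_iff mult.commute)

lemma cadjoint_cadjoint [simp]: "cadjoint (cadjoint A) = A"
  by (simp add: cadjoint_def transpose_def vec_eq_iff)

lemma cadjoint_spin: "cadjoint (spin x) = spin x"
  by (simp add: vec_eq_iff forall_2 cadjoint_def transpose_def spin_components)

lemma ex_spin_conj:
  assumes "u \<in> SU2" shows "\<exists>y. spin y = u ** spin x ** cadjoint u"
proof (rule ex_spin)
  show "cadjoint (u ** spin x ** cadjoint u) = u ** spin x ** cadjoint u"
    by (simp add: cadjoint_mult cadjoint_spin matrix_mul_assoc)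
  have "trace (u ** spin x ** cadjoint u) = trace (cadjoint u ** (u ** spin x))"
    by (rule trace_mul_sym)
  also have "\<dots> = 0"
    using assms by (simp add: SU2_def matrix_mul_assoc trace_def sum_2 spin_components)
  finally show "trace (u ** spin x ** cadjoint u) = 0" .
qed

definition so3_action :: "complex^2^2 \<Rightarrow> real^3 \<Rightarrow> real^3" where
  "so3_action u x = (THE y. spin y = u ** spin x ** cadjoint u)"

lemma spin_so3_action:
  assumes "u \<in> SU2" shows "spin (so3_action u x) = u ** spin x ** cadjoint u"
  unfolding so3_action_def using ex_spin_conj[OF assms, of x] spin_inject
  by (metis (mono_tags, lifting) theI)

lemma isu2_elem_block: "translation x ** rotation u = block u (cscale \<i> (spin x ** u)) 0 u"
  by (simp add: translation_def rotation_def block_mult block_eq_iff)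
    (simp add: cscale_def vec_eq_iff mat_mult_2 algebra_simps)

lemma SU2_mult: "u \<in> SU2 \<Longrightarrow> v \<in> SU2 \<Longrightarrow> u ** v \<in> SU2"
  unfolding SU2_def mem_Collect_eq cadjoint_mult det_mul
  by (metis matrix_mul_assoc matrix_mul_rid mult_1)

lemma SU2_cadjoint: "u \<in> SU2 \<Longrightarrow> cadjoint u \<in> SU2"
  unfolding SU2_def mem_Collect_eq cadjoint_cadjoint
  by (metis det_I det_mul mult_1)

lemma SU2_one: "mat 1 \<in> SU2"
proof -
  have "cadjoint (mat 1 :: complex^2^2) = mat 1"
    by (simp add: cadjoint_def transpose_def mat_def vec_eq_iff forall_2)
  then show ?thesis by (simp add: SU2_def)
qed

lemma isu2_elem_mult:
  assumes "u \<in> SU2"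
  shows "(translation x ** rotation u) ** (translation y ** rotation v) =
    translation (x + so3_action u y) ** rotation (u ** v)"
proof -
  have d: "(A + B) ** C = A ** C + B ** C" for A B C :: "complex^2^2"
    by (simp add: vec_eq_iff mat_mult_2 algebra_simps)
  have "(u ** spin y ** cadjoint u) ** (u ** v) = u ** spin y ** (cadjoint u ** u) ** v"
    by (simp only: matrix_mul_assoc)
  also have "\<dots> = u ** spin y ** v" using assms by (simp add: SU2_def)
  finally have "spin (x + so3_action u y) ** (u ** v) = spin x ** u ** v + u ** spin y ** v"
    using assms by (simp add: spin_add spin_so3_action d matrix_mul_assoc)
  then show ?thesis
    by (simp add: isu2_elem_block block_mult block_eq_iff)
      (simp add: cscale_def vec_eq_iff mat_mult_2 algebra_simps)
qed

lemma isu2_elem_inject: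
  assumes "u \<in> SU2"
  shows "translation x ** rotation u = translation y ** rotation v \<longleftrightarrow> x = y \<and> u = v"
proof
  assume "translation x ** rotation u = translation y ** rotation v"
  then have uv: "u = v" and e: "cscale \<i> (spin x ** u) = cscale \<i> (spin y ** u)"
    by (auto simp: isu2_elem_block block_eq_iff)
  then have "spin x ** u = spin y ** u" by (simp add: cscale_def vec_eq_iff)
  then have "spin x ** (u ** cadjoint u) = spin y ** (u ** cadjoint u)"
    by (simp add: matrix_mul_assoc)
  then show "x = y \<and> u = v" using uv assms by (simp add: SU2_def spin_inject)
qed simp

lemma spin_0 [simp]: "spin 0 = 0"
  by (simp add: spin_def)

lemma isu2_elem_one: "translation 0 ** rotation (mat 1) = mat 1"
  by (auto simp: isu2_elem_block block_def cscale_def vec_eq_iff mat_def split: sum.split)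

lemma isu2_exp_translation: "isu2_exp 0 X = translation X"
proof -
  let ?A = "cscale \<i> (\<Sum>a\<in>UNIV. (X $ a) *\<^sub>R isu2_P a)"
  have A: "?A = block 0 (cscale \<i> (spin X)) 0 0"
    by (auto simp: isu2_P_def spin_def block_def cscale_def vec_eq_iff sum_3 split: sum.split)
  have "?A ** ?A = 0"
    unfolding A block_mult by (auto simp: block_def vec_eq_iff split: sum.split)
  then have p: "matpow ?A (Suc (Suc n)) = 0" for n
    by (simp add: matrix_mul_assoc)
  have "mexp ?A = (\<Sum>n<2. (1 / fact n) *\<^sub>R matpow ?A n)"
    unfolding mexp_def
  proof (rule suminf_finite)
    fix n :: nat assume "n \<notin> {..<2}"
    then obtain m where "n = Suc (Suc m)"
      by (metis Suc_1 add_2_eq_Suc le_Suc_ex lessThan_iff not_less)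
    then show "(1 / fact n) *\<^sub>R matpow ?A n = 0" using p by simp
  qed simp
  also have "\<dots> = mat 1 + ?A" by (simp add: numeral_2_eq_2)
  also have "\<dots> = translation X"
    unfolding A by (auto simp: translation_def block_def vec_eq_iff mat_def split: sum.split)
  finally show ?thesis by (simp add: isu2_exp_def)
qed

lemma group_ISU2: "group ISU2"
proof (rule groupI)
  show "\<one>\<^bsub>ISU2\<^esub> \<in> carrier ISU2"
    using SU2_one by (auto simp: ISU2_def intro!: exI[of _ 0] exI[of _ "mat 1"] isu2_elem_one[symmetric])
  show "x \<otimes>\<^bsub>ISU2\<^esub> y \<in> carrier ISU2" if "x \<in> carrier ISU2" "y \<in> carrier ISU2" for x y
    using that isu2_elem_mult SU2_mult by (fastforce simp: ISU2_def)
  show "\<exists>y\<in>carrier ISU2. y \<otimes>\<^bsub>ISU2\<^esub> x = \<one>\<^bsub>ISU2\<^esub>" if x_in: "x \<in> carrier ISU2" for x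
  proof -
    obtain a u where x: "x = translation a ** rotation u" and u: "u \<in> SU2"
      using x_in by (auto simp: ISU2_def)
    let ?b = "- so3_action (cadjoint u) a"
    have "translation ?b ** rotation (cadjoint u) ** x = mat 1"
      using u by (simp add: x isu2_elem_mult SU2_cadjoint)
        (simp add: isu2_elem_one SU2_def)
    moreover have "translation ?b ** rotation (cadjoint u) \<in> carrier ISU2"
      using SU2_cadjoint[OF u] by (auto simp: ISU2_def)
    ultimately show ?thesis by (auto simp: ISU2_def)
  qed
qed (auto simp: ISU2_def matrix_mul_assoc)

end

(* The block matrices in ISU(2) are the unit dual quaternions q + eps q', with eps^2 = 0.  An element
   K = n + eps k with |n| = 1 and n orthogonal to k satisfies K^2 = -1, so the exponential of
   (h + eps c) K is given by Euler's formula; every generic element arises this way (as a screw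
   motion).  Two generic elements are conjugate iff the scalar parts of q and q' agree and, for q = 1,
   also |q'| agrees.  With h = r1 / 2 these scalar parts are cos h and - r2 sin h / (2 r1).  They are
   global coordinates on the classes with r1 > 0.  Near r1 = 0 the space of classes is not even
   Hausdorff, and the set of labels is not open in the plane, which contradicts invariance of domain. *)

theory Submission
  imports Defs "HOL-Homology.Invariance_of_Domain"
begin

text \<open>The singularity has an algebraic cause. Conjugating \<open>dquat t x s y\<close> by a
  translation adds to \<open>y\<close> an arbitrary vector orthogonal to \<open>x\<close>. If
  \<open>x\<close> is nonzero, only the inner product of \<open>x\<close> and \<open>y\<close>
  survives this, and it equals - t s for every element of the group, so (t, s) is a complete
  invariant. If \<open>x = 0\<close>, translations act trivially, a generic element has t = 1 and s
  = 0, and the length of \<open>y\<close> becomes a new invariant. Translations of different lengths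
  are therefore limits of elements with equal (t, s), which is why the quotient topology cannot
  separate their classes. "Does not parametrize a manifold" has two readings: the quotient space of
  classes and the set of labels inside the plane. The latter is Hausdorff, so it needs a different
  argument. Half angles appear throughout because SU(2) is the double cover of the rotation
  group.\<close>

unbundle cross3_syntax

subsection \<open>Quaternions and dual quaternions\<close>

text \<open>\<open>quat t x\<close> is \<open>t + i (x\<^sub>1 \<sigma>\<^sub>1 + x\<^sub>2 \<sigma>\<^sub>2 + x\<^sub>3 \<sigma>\<^sub>3)\<close>, that is, \<open>t + 2 i spin x\<close>.\<close>

definition quat :: "real \<Rightarrow> real^3 \<Rightarrow> complex^2^2" where
  "quat t x = vector [vector [Complex t (x$3), Complex (x$2) (x$1)],
                      vector [Complex (- (x$2)) (x$1), Complex t (- (x$3))]]"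

lemma quat_components:
  "quat t x $ 1 $ 1 = Complex t (x$3)" "quat t x $ 1 $ 2 = Complex (x$2) (x$1)"
  "quat t x $ 2 $ 1 = Complex (- (x$2)) (x$1)" "quat t x $ 2 $ 2 = Complex t (- (x$3))"
  by (simp_all add: quat_def)

text \<open>The cross product carries a minus sign because the imaginary units are i sigma_a, and (i
  sigma_1) (i sigma_2) = - i sigma_3.\<close>

lemma quat_mult:
  "quat t x ** quat s y = quat (t * s - x \<bullet> y) (t *\<^sub>R y + s *\<^sub>R x - x \<times> y)"
  by (simp add: vec_eq_iff forall_2 mat_mult_2 quat_components complex_eq_iff cross3_def
      inner_vec_def sum_3 algebra_simps)

lemma quat_eq_iff: "quat t x = quat s y \<longleftrightarrow> t = s \<and> x = y"
  by (auto simp: vec_eq_iff forall_2 forall_3 quat_components complex_eq_iff)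

lemma quat_add: "quat t x + quat s y = quat (t + s) (x + y)"
  by (simp add: vec_eq_iff forall_2 quat_components complex_eq_iff)

lemma quat_scaleR: "c *\<^sub>R quat t x = quat (c * t) (c *\<^sub>R x)"
  by (simp add: vec_eq_iff forall_2 quat_components complex_eq_iff)

lemma quat_0: "quat 0 0 = 0"
  by (simp add: vec_eq_iff forall_2 quat_components complex_eq_iff)

lemma quat_1: "quat 1 0 = mat 1"
  by (simp add: vec_eq_iff forall_2 quat_components complex_eq_iff mat_def)

lemma quat_minus_1: "quat (- 1) 0 = - mat 1"
  by (simp add: vec_eq_iff forall_2 quat_components complex_eq_iff mat_def)

lemma cscale_spin: "cscale \<i> (spin x) = quat 0 ((1/2) *\<^sub>R x)"
  by (simp add: cscale_def vec_eq_iff forall_2 quat_components complex_eq_iff spin_components)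

lemma cadjoint_quat: "cadjoint (quat t x) = quat t (- x)"
  by (simp add: cadjoint_def transpose_def vec_eq_iff forall_2 quat_components complex_eq_iff)

lemma det_quat: "det (quat t x) = complex_of_real (t\<^sup>2 + x \<bullet> x)"
  by (simp add: det_2 quat_components complex_eq_iff inner_vec_def sum_3 power2_eq_square)

lemma SU2_eq_quat: "SU2 = {quat t x | t x. t\<^sup>2 + x \<bullet> x = 1}"
proof (intro subset_antisym subsetI)
  fix u assume "u \<in> {quat t x | t x. t\<^sup>2 + x \<bullet> x = 1}"
  then obtain t x where u: "u = quat t x" and n: "t\<^sup>2 + x \<bullet> x = 1" by blast
  have "det u = 1" by (simp only: u det_quat n of_real_1)
  then show "u \<in> SU2"
    using n by (simp add: SU2_def u cadjoint_quat quat_mult power2_eq_square flip: quat_1)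
next
  fix u assume "u \<in> SU2"
  then have ua: "cadjoint u ** u = mat 1" and d: "det u = 1" by (auto simp: SU2_def)
  have d': "u$1$1 * u$2$2 - u$1$2 * u$2$1 = 1" using d by (simp add: det_2)
  have e: "cnj (u$1$1) * u$1$1 + cnj (u$2$1) * u$2$1 = 1"
      "cnj (u$1$1) * u$1$2 + cnj (u$2$1) * u$2$2 = 0"
    using arg_cong[OF ua, of "\<lambda>A. A $ 1 $ 1"] arg_cong[OF ua, of "\<lambda>A. A $ 1 $ 2"]
    by (simp_all add: mat_mult_2 cadjoint_def transpose_def mat_def)
  \<comment> \<open>\<open>cadjoint u\<close> and the adjugate of \<open>u\<close> both invert
    \<open>u\<close>, hence agree. This identity and the next write the difference of two of their
    entries as a combination of the relations \<open>e\<close> and \<open>d'\<close>, all of which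
    vanish.\<close>
  have "u$2$2 - cnj (u$1$1) = - u$2$2 * (cnj (u$1$1) * u$1$1 + cnj (u$2$1) * u$2$1 - 1)
      + cnj (u$1$1) * (u$1$1 * u$2$2 - u$1$2 * u$2$1 - 1)
      + u$2$1 * (cnj (u$1$1) * u$1$2 + cnj (u$2$1) * u$2$2)"
    by (simp add: algebra_simps)
  then have u22: "u$2$2 = cnj (u$1$1)" unfolding e d' by simp
  have "u$1$2 + cnj (u$2$1) = - u$1$2 * (cnj (u$1$1) * u$1$1 + cnj (u$2$1) * u$2$1 - 1)
      - cnj (u$2$1) * (u$1$1 * u$2$2 - u$1$2 * u$2$1 - 1)
      + u$1$1 * (cnj (u$1$1) * u$1$2 + cnj (u$2$1) * u$2$2)"
    by (simp add: algebra_simps)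
  then have u12: "u$1$2 = - cnj (u$2$1)" unfolding e d' by (simp add: add_eq_0_iff)
  let ?t = "Re (u$1$1)"
  let ?x = "vector [Im (u$1$2), Re (u$1$2), Im (u$1$1)] :: real^3"
  have "u = quat ?t ?x"
    using u22 u12 by (simp add: vec_eq_iff forall_2 quat_components complex_eq_iff)
  moreover from this have "?t\<^sup>2 + ?x \<bullet> ?x = 1"
    using d det_quat[of ?t ?x] of_real_eq_1_iff by metis
  ultimately show "u \<in> {quat t x | t x. t\<^sup>2 + x \<bullet> x = 1}" by blast
qed

section \<open>Dual quaternion coordinates on the group\<close>

text \<open>The dual quaternion \<open>quat t x + \<epsilon> quat s y\<close>, with \<open>\<epsilon>\<^sup>2 = 0\<close>.\<close>

definition dquat :: "real \<Rightarrow> real^3 \<Rightarrow> real \<Rightarrow> real^3 \<Rightarrow> isu2_mat" where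
  "dquat t x s y = block (quat t x) (quat s y) 0 (quat t x)"

lemma dquat_mult:
  "dquat t x s y ** dquat t' x' s' y' =
     dquat (t * t' - x \<bullet> x') (t *\<^sub>R x' + t' *\<^sub>R x - x \<times> x')
       (t * s' + s * t' - x \<bullet> y' - y \<bullet> x')
       (t *\<^sub>R y' + s' *\<^sub>R x - x \<times> y' + s *\<^sub>R x' + t' *\<^sub>R y - y \<times> x')"
  by (simp add: dquat_def block_mult quat_mult quat_add algebra_simps)

lemma dquat_eq_iff:
  "dquat t x s y = dquat t' x' s' y' \<longleftrightarrow> t = t' \<and> x = x' \<and> s = s' \<and> y = y'"
  by (auto simp: dquat_def block_eq_iff quat_eq_iff)

lemma block_add: "block A B C D + block A' B' C' D' = block (A+A') (B+B') (C+C') (D+D')"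
  by (auto simp: block_def vec_eq_iff split: sum.split)

lemma block_scaleR: "c *\<^sub>R block A B C D = block (c *\<^sub>R A) (c *\<^sub>R B) (c *\<^sub>R C) (c *\<^sub>R D)"
  by (auto simp: block_def vec_eq_iff split: sum.split)

lemma dquat_add:
  "dquat t x s y + dquat t' x' s' y' = dquat (t + t') (x + x') (s + s') (y + y')"
  by (simp add: dquat_def block_add quat_add)

lemma dquat_scaleR: "c *\<^sub>R dquat t x s y = dquat (c * t) (c *\<^sub>R x) (c * s) (c *\<^sub>R y)"
  by (simp add: dquat_def block_scaleR quat_scaleR)

lemma dquat_1: "dquat 1 0 0 0 = mat 1"
  by (auto simp: dquat_def quat_1 quat_0 block_def vec_eq_iff mat_def split: sum.split)

text \<open>The factor 2 cancels the 1/2 in \<open>spin\<close>, so that the dual part is the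
  product of the pure quaternion \<open>quat 0 p\<close> and \<open>quat t v\<close>.\<close>

lemma translation_rotation_quat:
  "translation (2 *\<^sub>R p) ** rotation (quat t v) = dquat t v (- (p \<bullet> v)) (t *\<^sub>R p - p \<times> v)"
  by (simp add: translation_def rotation_def cscale_spin dquat_def block_mult quat_mult)

text \<open>The translation is recovered as the quotient \<open>quat s y ** quat t (- x)\<close> of
  the dual part by the rotation. Its scalar part is t s plus the inner product of \<open>x\<close>
  and \<open>y\<close>, so the second hypothesis makes it a pure vector.\<close>

lemma dquat_eq_translation_rotation:
  assumes "t\<^sup>2 + x \<bullet> x = 1" "t * s + x \<bullet> y = 0"
  shows "dquat t x s y = translation (2 *\<^sub>R (t *\<^sub>R y - s *\<^sub>R x + y \<times> x)) ** rotation (quat t x)"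
  (is "_ = translation (2 *\<^sub>R ?p) ** _")
proof -
  have "?p \<bullet> x = t * (y \<bullet> x) - s * (x \<bullet> x)"
    by (simp add: inner_add_left inner_diff_left dot_cross_self)
  also have "\<dots> = - s * (t\<^sup>2 + x \<bullet> x)" 
  proof -
    have "y \<bullet> x = - (t * s)" using assms(2) by (simp add: inner_commute)
    then show ?thesis by (simp add: algebra_simps power2_eq_square)
  qed
  finally have s: "s = - (?p \<bullet> x)" using assms(1) by simp
  have "?p \<times> x = t *\<^sub>R (y \<times> x) + (y \<times> x) \<times> x"
    by (simp add: cross_add_left cross_mult_left Cross3.left_diff_distrib)
  also have "(y \<times> x) \<times> x = (x \<bullet> y) *\<^sub>R x - (x \<bullet> x) *\<^sub>R y"
    by (simp add: cross_skew[of "y \<times> x"] Lagrange)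
  also have "t *\<^sub>R ?p - (t *\<^sub>R (y \<times> x) + \<dots>) = (t\<^sup>2 + x \<bullet> x) *\<^sub>R y - (t * s + x \<bullet> y) *\<^sub>R x"
    by (simp add: algebra_simps power2_eq_square)
  finally have y: "y = t *\<^sub>R ?p - ?p \<times> x" using assms by simp
  show ?thesis
    unfolding translation_rotation_quat dquat_eq_iff
    using s y by simp
qed

text \<open>The two equations are the real and the dual part of the statement that the dual
  quaternion has norm 1. They describe the tangent bundle of the 3-sphere.\<close>

lemma carrier_ISU2_dquat:
  "carrier ISU2 = {dquat t x s y | t x s y. t\<^sup>2 + x \<bullet> x = 1 \<and> t * s + x \<bullet> y = 0}"
proof (intro subset_antisym subsetI)
  fix M assume "M \<in> carrier ISU2"
  then obtain p t v where M: "M = translation p ** rotation (quat t v)" and n: "t\<^sup>2 + v \<bullet> v = 1"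
    unfolding ISU2_def SU2_eq_quat by auto
  define q where "q = (1/2) *\<^sub>R p"
  have "p = 2 *\<^sub>R q" by (simp add: q_def)
  then have "M = dquat t v (- (q \<bullet> v)) (t *\<^sub>R q - q \<times> v)"
    by (simp only: M translation_rotation_quat)
  moreover have "t * - (q \<bullet> v) + v \<bullet> (t *\<^sub>R q - q \<times> v) = 0"
    by (simp add: inner_diff_right dot_cross_self inner_commute)
  ultimately show "M \<in> {dquat t x s y | t x s y. t\<^sup>2 + x \<bullet> x = 1 \<and> t * s + x \<bullet> y = 0}"
    using n by blast
next
  fix M assume "M \<in> {dquat t x s y | t x s y. t\<^sup>2 + x \<bullet> x = 1 \<and> t * s + x \<bullet> y = 0}"
  then obtain t x s y where M: "M = dquat t x s y" and n: "t\<^sup>2 + x \<bullet> x = 1" "t * s + x \<bullet> y = 0"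
    by blast
  have "quat t x \<in> SU2" using n(1) unfolding SU2_eq_quat by blast
  then show "M \<in> carrier ISU2"
    unfolding M dquat_eq_translation_rotation[OF n] ISU2_def by auto
qed

lemma dquat_in_carrier:
  "dquat t x s y \<in> carrier ISU2 \<longleftrightarrow> t\<^sup>2 + x \<bullet> x = 1 \<and> t * s + x \<bullet> y = 0"
  unfolding carrier_ISU2_dquat mem_Collect_eq dquat_eq_iff by blast

lemma ISU2_generic_iff:
  "M \<in> ISU2_generic \<longleftrightarrow> M \<in> carrier ISU2 \<and> (\<forall>B. M \<noteq> block (- mat 1) B 0 (- mat 1))"
proof
  assume "M \<in> ISU2_generic"
  then show "M \<in> carrier ISU2 \<and> (\<forall>B. M \<noteq> block (- mat 1) B 0 (- mat 1))"
    unfolding ISU2_generic_def ISU2_def by (auto simp: isu2_elem_block block_eq_iff)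
next
  assume M: "M \<in> carrier ISU2 \<and> (\<forall>B. M \<noteq> block (- mat 1) B 0 (- mat 1))"
  then obtain x u where "M = translation x ** rotation u" "u \<in> SU2"
    unfolding ISU2_def by auto
  moreover from this M have "u \<noteq> - mat 1" by (auto simp: isu2_elem_block)
  ultimately show "M \<in> ISU2_generic"
    unfolding ISU2_generic_def by blast
qed

text \<open>On the unit sphere t = -1 forces x = 0, so excluding the rotation part -1 is a condition
  on the single number \<open>t\<close>.\<close>

lemma dquat_in_generic:
  "dquat t x s y \<in> ISU2_generic \<longleftrightarrow> t\<^sup>2 + x \<bullet> x = 1 \<and> t * s + x \<bullet> y = 0 \<and> t \<noteq> - 1"
proof -
  have "(\<exists>B. dquat t x s y = block (- mat 1) B 0 (- mat 1)) \<longleftrightarrow> t = - 1 \<and> x = 0"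
    unfolding dquat_def block_eq_iff quat_minus_1[symmetric] quat_eq_iff by blast
  moreover have "x = 0" if "t\<^sup>2 + x \<bullet> x = 1" "t = - 1"
    using that by simp
  ultimately show ?thesis
    unfolding ISU2_generic_iff dquat_in_carrier by blast
qed

lemma ISU2_genericE:
  assumes "M \<in> ISU2_generic"
  obtains t x s y where "M = dquat t x s y" "t\<^sup>2 + x \<bullet> x = 1" "t * s + x \<bullet> y = 0" "t \<noteq> - 1"
proof -
  have "M \<in> carrier ISU2" using assms ISU2_generic_iff by blast
  then obtain t x s y where "M = dquat t x s y" unfolding carrier_ISU2_dquat by blast
  then show ?thesis using assms that dquat_in_generic by blast
qed

subsection \<open>The exponential map\<close>

lemma isu2_exp_eq_mexp_dquat:
  "isu2_exp (2 *\<^sub>R x) (2 *\<^sub>R y) = mexp (dquat 0 x 0 y)"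
proof -
  have "cscale \<i> (\<Sum>a\<in>UNIV. (\<Theta> $ a) *\<^sub>R isu2_J a + (X $ a) *\<^sub>R isu2_P a) =
      block (cscale \<i> (spin \<Theta>)) (cscale \<i> (spin X)) 0 (cscale \<i> (spin \<Theta>))" for \<Theta> X
    by (auto simp: isu2_J_def isu2_P_def spin_def block_def cscale_def vec_eq_iff sum_3
        split: sum.split)
  then show ?thesis
    unfolding isu2_exp_def by (simp only: cscale_spin dquat_def scaleR_scaleR) simp
qed

lemma mexp_dquat:
  assumes "n \<bullet> n = 1" "n \<bullet> k = 0"
  shows "mexp (dquat 0 (h *\<^sub>R n) 0 (c *\<^sub>R n + h *\<^sub>R k)) =
    dquat (cos h) (sin h *\<^sub>R n) (- (c * sin h)) ((c * cos h) *\<^sub>R n + sin h *\<^sub>R k)"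
proof -
  text \<open>As \<open>n + \<epsilon> k\<close> squares to \<open>-1\<close>, the elements \<open>\<Phi> z + \<Omega> w\<close> multiply like the dual
    complex numbers \<open>z + \<epsilon> w\<close>.\<close>
  define \<Phi> where "\<Phi> z = dquat (Re z) (Im z *\<^sub>R n) 0 (Im z *\<^sub>R k)" for z
  define \<Omega> where "\<Omega> w = dquat 0 0 (Re w) (Im w *\<^sub>R n)" for w
  have PO: "\<Phi> z + \<Omega> w = dquat (Re z) (Im z *\<^sub>R n) (Re w) (Im w *\<^sub>R n + Im z *\<^sub>R k)" for z w
    by (simp add: \<Phi>_def \<Omega>_def dquat_add add.commute)
  have kn: "k \<bullet> n = 0" using assms by (simp add: inner_commute)
  have cr: "k \<times> n = - (n \<times> k)" by (rule cross_skew)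
  have mult: "(\<Phi> z + \<Omega> w) ** (\<Phi> z' + \<Omega> w') = \<Phi> (z * z') + \<Omega> (z * w' + w * z')" for z w z' w'
    unfolding PO dquat_mult dquat_eq_iff
    by (simp add: assms kn cr inner_add_left inner_add_right cross_add_left cross_add_right
        cross_mult_left cross_mult_right algebra_simps)
  have "linear \<Phi>" "linear \<Omega>"
    by (auto intro!: linearI simp: \<Phi>_def \<Omega>_def dquat_add dquat_scaleR algebra_simps)
  then have bl: "bounded_linear \<Phi>" "bounded_linear \<Omega>"
    by (simp_all add: linear_conv_bounded_linear)
  define z where "z = \<i> * complex_of_real h"
  define w where "w = \<i> * complex_of_real c"
  \<comment> \<open>As for dual numbers, the second component is the derivative of the m-th power at
    \<open>z\<close> applied to \<open>w\<close>. At m = 0 the truncated exponent does no harm,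
    since the factor \<open>of_nat m\<close> is 0.\<close>
  have pow: "matpow (\<Phi> z + \<Omega> w) m = \<Phi> (z ^ m) + \<Omega> (of_nat m * z ^ (m - 1) * w)" for m
  proof (induction m)
    case 0
    show ?case by (simp add: PO dquat_1)
  next
    case (Suc m)
    have "z * (of_nat m * z ^ (m - 1) * w) + w * z ^ m = of_nat (Suc m) * z ^ m * w"
      by (cases m) (simp_all add: algebra_simps)
    then show ?case by (simp add: Suc mult)
  qed
  have e: "(\<lambda>m. z ^ m /\<^sub>R fact m) sums exp z" by (rule exp_converges)
  \<comment> \<open>The term for m = 0 is the summand 0; shifting the index by one turns the
    remaining series into exp z times w.\<close>
  have "(\<lambda>m. (of_nat m * z ^ (m - 1) * w) /\<^sub>R fact m) sums (exp z * w + 0)"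
  proof -
    have "(of_nat (Suc m) * z ^ (Suc m - 1) * w) /\<^sub>R fact (Suc m) = (z ^ m /\<^sub>R fact m) * w" for m
      by (simp add: scaleR_conv_of_real field_simps del: of_nat_Suc)
    then have "(\<lambda>m. (of_nat (Suc m) * z ^ (Suc m - 1) * w) /\<^sub>R fact (Suc m)) sums (exp z * w)"
      using sums_mult2[OF e, of w] by simp
    from sums_Suc[OF this] show ?thesis by simp
  qed
  then have "(\<lambda>m. \<Phi> (z ^ m /\<^sub>R fact m) + \<Omega> ((of_nat m * z ^ (m - 1) * w) /\<^sub>R fact m))
      sums (\<Phi> (exp z) + \<Omega> (exp z * w))"
    using bounded_linear.sums[OF bl(1) e] bounded_linear.sums[OF bl(2)] sums_add by fastforce
  then have "(\<lambda>m. (1 / fact m) *\<^sub>R matpow (\<Phi> z + \<Omega> w) m) sums (\<Phi> (exp z) + \<Omega> (exp z * w))"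
    using bl[THEN bounded_linear.linear, THEN linear_scale]
    by (simp add: pow scaleR_add_right divide_inverse)
  then have "mexp (\<Phi> z + \<Omega> w) = \<Phi> (exp z) + \<Omega> (exp z * w)"
    unfolding mexp_def by (rule sums_unique[symmetric])
  moreover have "exp z = cis h" by (simp add: z_def cis_conv_exp)
  ultimately show ?thesis
    unfolding PO by (simp add: z_def w_def mult.commute)
qed

text \<open>A screw motion: rotation by 2h with a displacement 2c along the axis. The vector
  \<open>k\<close> records the position of the axis, as n + eps k is a conjugate of n by a
  translation.\<close>

lemma isu2_exp_screw:
  assumes "n \<bullet> n = 1" "n \<bullet> k = 0"
  shows "isu2_exp ((2 * h) *\<^sub>R n) ((2 * c) *\<^sub>R n + (2 * h) *\<^sub>R k) =
    dquat (cos h) (sin h *\<^sub>R n) (- (c * sin h)) ((c * cos h) *\<^sub>R n + sin h *\<^sub>R k)"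
  using isu2_exp_eq_mexp_dquat[of "h *\<^sub>R n" "c *\<^sub>R n + h *\<^sub>R k"] mexp_dquat[OF assms]
  by (simp add: scaleR_add_right)

lemma isu2_exp_0: "isu2_exp 0 X = dquat 1 0 0 ((1/2) *\<^sub>R X)"
  by (simp add: isu2_exp_translation translation_def cscale_spin dquat_def quat_1)

text \<open>Conjugacy sees only the scalar parts when the rotation is nontrivial. So
  \<open>y\<close> stays abstract, except for the inner product that membership in the group
  requires.\<close>

lemma isu2_exp_dquatE:
  assumes "\<Theta> \<noteq> 0"
  obtains n y where "n \<bullet> n = 1"
    "isu2_exp \<Theta> X = dquat (cos (norm \<Theta> / 2)) (sin (norm \<Theta> / 2) *\<^sub>R n)
       (- (\<Theta> \<bullet> X / (2 * norm \<Theta>) * sin (norm \<Theta> / 2))) y"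
    "sin (norm \<Theta> / 2) *\<^sub>R n \<bullet> y = cos (norm \<Theta> / 2) * (\<Theta> \<bullet> X / (2 * norm \<Theta>) * sin (norm \<Theta> / 2))"
proof -
  define h where "h = norm \<Theta> / 2"
  define n where "n = (1 / norm \<Theta>) *\<^sub>R \<Theta>"
  define c where "c = \<Theta> \<bullet> X / (2 * norm \<Theta>)"
  \<comment> \<open>Splitting \<open>X\<close> along and across the axis gives X = 2c n + 2h k;
    dividing by 2h, the norm of \<Theta>, requires a nonzero rotation.\<close>
  define k where "k = (1 / norm \<Theta>) *\<^sub>R (X - (2 * c) *\<^sub>R n)"
  have n: "n \<bullet> n = 1"
    using assms by (simp add: n_def dot_square_norm power2_eq_square)
  have "n \<bullet> X = 2 * c" by (simp add: n_def c_def)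
  then have nk: "n \<bullet> k = 0"
    using n by (simp add: k_def inner_diff_right)
  have "\<Theta> = (2 * h) *\<^sub>R n" "X = (2 * c) *\<^sub>R n + (2 * h) *\<^sub>R k"
    using assms by (simp_all add: h_def n_def k_def)
  then have "isu2_exp \<Theta> X =
      dquat (cos h) (sin h *\<^sub>R n) (- (c * sin h)) ((c * cos h) *\<^sub>R n + sin h *\<^sub>R k)"
    using isu2_exp_screw[OF n nk, of h c] by simp
  moreover have "sin h *\<^sub>R n \<bullet> ((c * cos h) *\<^sub>R n + sin h *\<^sub>R k) = cos h * (c * sin h)"
    unfolding inner_add_right by (simp add: n nk)
  ultimately show ?thesis
    using n that unfolding h_def c_def by blast
qed

lemma isu2_exp_image: "{isu2_exp \<Theta> X | \<Theta> X. norm \<Theta> < 2 * pi} = ISU2_generic"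
proof (intro subset_antisym subsetI)
  fix M assume "M \<in> {isu2_exp \<Theta> X | \<Theta> X. norm \<Theta> < 2 * pi}"
  then obtain \<Theta> X where M: "M = isu2_exp \<Theta> X" and less: "norm \<Theta> < 2 * pi" by blast
  show "M \<in> ISU2_generic"
  proof (cases "\<Theta> = 0")
    case True
    then show ?thesis by (simp add: M isu2_exp_0 dquat_in_generic)
  next
    case False
    have "cos (norm \<Theta> / 2) \<noteq> cos pi"
      using less by (intro less_imp_neq[symmetric] cos_monotone_0_pi) auto
    moreover obtain n y where "n \<bullet> n = 1"
      "M = dquat (cos (norm \<Theta> / 2)) (sin (norm \<Theta> / 2) *\<^sub>R n)
         (- (\<Theta> \<bullet> X / (2 * norm \<Theta>) * sin (norm \<Theta> / 2))) y"
      "sin (norm \<Theta> / 2) *\<^sub>R n \<bullet> y = cos (norm \<Theta> / 2) * (\<Theta> \<bullet> X / (2 * norm \<Theta>) * sin (norm \<Theta> / 2))"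
      unfolding M by (rule isu2_exp_dquatE[OF False])
    ultimately show ?thesis
      by (simp add: dquat_in_generic flip: power2_eq_square)
  qed
next
  fix M assume "M \<in> ISU2_generic"
  then obtain t x s y where M: "M = dquat t x s y"
    and 1: "t\<^sup>2 + x \<bullet> x = 1" and 2: "t * s + x \<bullet> y = 0" and t: "t \<noteq> - 1"
    by (rule ISU2_genericE)
  have "t\<^sup>2 \<le> 1" using 1 inner_ge_zero[of x] by linarith
  then have t1: "- 1 < t" "t \<le> 1" using t by (auto simp: abs_square_le_1 abs_le_iff)
  show "M \<in> {isu2_exp \<Theta> X | \<Theta> X. norm \<Theta> < 2 * pi}"
  proof (cases "x = 0")
    case True
    then have "t = 1" using 1 t power2_eq_1_iff by auto
    then have "M = isu2_exp 0 (2 *\<^sub>R y)"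
      using 2 True by (simp add: M isu2_exp_0)
    then show ?thesis by (force intro: exI[of _ 0])
  next
    case False
    define h where "h = arccos t"
    have h: "cos h = t" "0 \<le> h" "h < pi"
      using t1 arccos_lt_bounded[of t] arccos_1 unfolding h_def
      by (cases "t = 1"; simp add: arccos_lbound)+
    have sq: "(sin h)\<^sup>2 = x \<bullet> x" using 1 h(1) sin_squared_eq[of h] by simp
    then have sin: "sin h \<noteq> 0" using False by auto
    \<comment> \<open>The formulas for \<open>n\<close>, \<open>c\<close> and \<open>k\<close> solve
      the components of \<open>isu2_exp_screw\<close> for the given \<open>x\<close>,
      \<open>s\<close> and \<open>y\<close>. The group condition \<open>2\<close> is what makes
      \<open>n\<close> and \<open>k\<close> orthogonal.\<close>
    define n where "n = (1 / sin h) *\<^sub>R x"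
    define c where "c = - s / sin h"
    define k where "k = (1 / sin h) *\<^sub>R (y - (c * t) *\<^sub>R n)"
    have n: "n \<bullet> n = 1"
      using sin by (simp add: n_def flip: sq power2_eq_square)
    have "n \<bullet> y = c * t"
      using 2 sin by (simp add: n_def c_def field_simps)
    then have nk: "n \<bullet> k = 0" using n by (simp add: k_def inner_diff_right)
    have "M = isu2_exp ((2 * h) *\<^sub>R n) ((2 * c) *\<^sub>R n + (2 * h) *\<^sub>R k)"
      unfolding isu2_exp_screw[OF n nk] M
      using sin by (simp add: dquat_eq_iff h n_def c_def k_def)
    moreover have "norm ((2 * h) *\<^sub>R n) < 2 * pi"
    proof -
      have "norm n = 1" using n by (simp add: norm_eq_sqrt_inner)
      then show ?thesis using h by simp
    qed
    ultimately show ?thesis by blast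
  qed
qed

subsection \<open>Conjugacy\<close>

context group
begin

text \<open>Writing conjugacy as h x = y h avoids inverses, so that it becomes an equation between
  products of dual quaternions.\<close>

lemma conjugacy_class_eq:
  assumes "x \<in> carrier G"
  shows "conjugacy_class G x = {y \<in> carrier G. \<exists>h\<in>carrier G. h \<otimes> x = y \<otimes> h}"
proof (intro subset_antisym subsetI)
  fix y assume "y \<in> conjugacy_class G x"
  then obtain h where "h \<in> carrier G" "y = h \<otimes> x \<otimes> inv h"
    using assms by (auto simp: conjugacy_class_def orbit_def)
  moreover from this have "h \<otimes> x = y \<otimes> h" "y \<in> carrier G"
    using assms by (simp_all add: m_assoc)
  ultimately show "y \<in> {y \<in> carrier G. \<exists>h\<in>carrier G. h \<otimes> x = y \<otimes> h}" by blast
next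
  fix y assume "y \<in> {y \<in> carrier G. \<exists>h\<in>carrier G. h \<otimes> x = y \<otimes> h}"
  then obtain h where "y \<in> carrier G" "h \<in> carrier G" "h \<otimes> x = y \<otimes> h" by blast
  then have "y = h \<otimes> x \<otimes> inv h" using assms by (metis inv_solve_right m_closed)
  then show "y \<in> conjugacy_class G x"
    using assms \<open>h \<in> carrier G\<close> unfolding conjugacy_class_def orbit_def by auto
qed

lemma conjugacy_class_eq_iff:
  assumes "x \<in> carrier G" "y \<in> carrier G"
  shows "conjugacy_class G x = conjugacy_class G y \<longleftrightarrow> (\<exists>h\<in>carrier G. h \<otimes> x = y \<otimes> h)"
proof
  assume "conjugacy_class G x = conjugacy_class G y"
  moreover have "y \<in> conjugacy_class G y"
    using assms one_closed l_one r_one unfolding conjugacy_class_eq[OF assms(2)] by force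
  ultimately show "\<exists>h\<in>carrier G. h \<otimes> x = y \<otimes> h"
    using assms by (auto simp: conjugacy_class_eq)
next
  have trans: "\<exists>h\<in>carrier G. h \<otimes> x = z \<otimes> h"
    if "x \<in> carrier G" "y \<in> carrier G" "z \<in> carrier G" "h \<in> carrier G" "g \<in> carrier G"
      "h \<otimes> x = y \<otimes> h" "g \<otimes> y = z \<otimes> g" for x y z g h
  proof (rule bexI)
    have "(g \<otimes> h) \<otimes> x = g \<otimes> (y \<otimes> h)" using that by (simp add: m_assoc)
    also have "\<dots> = (z \<otimes> g) \<otimes> h" using that by (simp flip: m_assoc)
    finally show "(g \<otimes> h) \<otimes> x = z \<otimes> (g \<otimes> h)" using that by (simp add: m_assoc)
    show "g \<otimes> h \<in> carrier G" using that by simp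
  qed
  assume "\<exists>h\<in>carrier G. h \<otimes> x = y \<otimes> h"
  then obtain h where h: "h \<in> carrier G" "h \<otimes> x = y \<otimes> h" by blast
  have inv_h: "inv h \<otimes> y = x \<otimes> inv h"
  proof -
    have y: "y = h \<otimes> x \<otimes> inv h" using assms h by (metis inv_solve_right m_closed)
    have "inv h \<otimes> y = (inv h \<otimes> h) \<otimes> (x \<otimes> inv h)"
      unfolding y using assms(1) h(1) by (simp only: m_assoc m_closed inv_closed)
    then show ?thesis using assms(1) h(1) by simp
  qed
  show "conjugacy_class G x = conjugacy_class G y"
    unfolding conjugacy_class_eq[OF assms(1)] conjugacy_class_eq[OF assms(2)]
  proof (intro subset_antisym subsetI)
    fix z assume "z \<in> {z \<in> carrier G. \<exists>g\<in>carrier G. g \<otimes> x = z \<otimes> g}"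
    then show "z \<in> {z \<in> carrier G. \<exists>g\<in>carrier G. g \<otimes> y = z \<otimes> g}"
      using trans[OF assms(2,1) _ inv_closed[OF h(1)] _ inv_h] by blast
  next
    fix z assume "z \<in> {z \<in> carrier G. \<exists>g\<in>carrier G. g \<otimes> y = z \<otimes> g}"
    then show "z \<in> {z \<in> carrier G. \<exists>g\<in>carrier G. g \<otimes> x = z \<otimes> g}"
      using trans[OF assms _ h(1) _ h(2)] by blast
  qed
qed

end

lemma conjugacy_class_ISU2_eq_iff:
  assumes "M \<in> carrier ISU2" "N \<in> carrier ISU2"
  shows "conjugacy_class ISU2 M = conjugacy_class ISU2 N \<longleftrightarrow>
    (\<exists>H\<in>carrier ISU2. H ** M = N ** H)"
  using group.conjugacy_class_eq_iff[OF group_ISU2 assms] by (simp add: ISU2_def)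

section \<open>Conjugation of quaternions\<close>

lemma quat_mult_cadjoint:
  assumes "a\<^sup>2 + b \<bullet> b = 1"
  shows "quat a b ** quat a (- b) = mat 1" "quat a (- b) ** quat a b = mat 1"
  using assms by (simp_all add: quat_mult power2_eq_square flip: quat_1)

lemma quat_conj_vector:
  assumes "a\<^sup>2 + b \<bullet> b = 1"
  obtains z where "quat a b ** quat 0 y = quat 0 z ** quat a b"
proof -
  \<comment> \<open>The vector part of q y q^-1 for q = \<open>quat a b\<close>, expanded by
    \<open>quat_mult\<close>; the scalar part stays 0.\<close>
  let ?z = "a *\<^sub>R (a *\<^sub>R y - b \<times> y) + (b \<bullet> y) *\<^sub>R b + (a *\<^sub>R y - b \<times> y) \<times> b"
  have "quat a b ** quat 0 y ** quat a (- b) = quat 0 ?z"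
    unfolding quat_mult quat_eq_iff
    by (simp add: inner_diff_left inner_diff_right dot_cross_self inner_commute mult.commute)
  then have "quat a b ** quat 0 y ** (quat a (- b) ** quat a b) = quat 0 ?z ** quat a b"
    by (simp only: matrix_mul_assoc)
  then show ?thesis
    using assms by (intro that[of ?z]) (simp add: quat_mult_cadjoint)
qed

lemma quat_conj_scalar:
  "quat a b ** quat 0 x = quat 0 z ** quat a b \<Longrightarrow> quat a b ** quat t x = quat t z ** quat a b"
  unfolding quat_mult quat_eq_iff by (simp add: algebra_simps)

text \<open>Rotations act transitively on each sphere around the origin.\<close>

lemma quat_conj_transitive:
  assumes "x \<bullet> x = z \<bullet> z"
  obtains a b where "a\<^sup>2 + b \<bullet> b = 1" "quat a b ** quat 0 x = quat 0 z ** quat a b"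
proof (cases "x + z = 0")
  case True
  then have z: "z = - x" by (simp add: add_eq_0_iff)
  \<comment> \<open>For z = - x the quaternion of the other case would be 0. A half turn about any
    axis orthogonal to \<open>x\<close> reverses \<open>x\<close>.\<close>
  obtain b :: "real^3" where b: "b \<noteq> 0" "x \<bullet> b = 0"
    using orthogonal_to_vector_exists[of x] by (auto simp: orthogonal_def)
  let ?b = "(1 / norm b) *\<^sub>R b"
  have "?b \<bullet> ?b = 1"
    using b(1) by (simp add: dot_square_norm power2_eq_square)
  moreover have "quat 0 ?b ** quat 0 x = quat 0 z ** quat 0 ?b"
    using b(2) unfolding quat_mult quat_eq_iff z
    by (simp add: inner_commute) (metis cross_skew)
  ultimately show ?thesis by (intro that[of 0 ?b]) auto
next
  case False
  \<comment> \<open>\<open>q = \<bar>x\<bar>\<^sup>2 - z x\<close> satisfies \<open>q x = z q\<close>.\<close>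
  define c where "c = x \<bullet> x + x \<bullet> z"
  define N where "N = c\<^sup>2 + (z \<times> x) \<bullet> (z \<times> x)"
  \<comment> \<open>As \<open>x\<close> and \<open>z\<close> have equal length, \<open>c\<close>
    vanishes only if x + z = 0; hence \<open>N\<close>, the squared norm of q, is positive and q can
    be normalised.\<close>
  have "2 * c = (x + z) \<bullet> (x + z)"
    using assms by (simp add: c_def inner_add_left inner_add_right inner_commute)
  then have "c \<noteq> 0" using False by auto
  then have N: "N > 0"
    by (simp add: N_def add_pos_nonneg)
  let ?r = "1 / sqrt N"
  have r: "?r * ?r * N = 1" using N by simp
  have q: "quat c (z \<times> x) ** quat 0 x = quat 0 z ** quat c (z \<times> x)"
    unfolding quat_mult quat_eq_iff
    by (simp add: dot_cross_self c_def assms cross_skew[of "z \<times> x" x] Lagrange inner_commute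
        algebra_simps)
  have "(?r *\<^sub>R quat c (z \<times> x)) ** quat 0 x = ?r *\<^sub>R (quat c (z \<times> x) ** quat 0 x)"
    by (rule scalar_matrix_assoc[symmetric])
  also have "\<dots> = (?r *\<^sub>R quat 0 z) ** quat c (z \<times> x)"
    unfolding q by (rule scalar_matrix_assoc)
  also have "\<dots> = quat 0 z ** (?r *\<^sub>R quat c (z \<times> x))"
    by (rule matrix_scalar_ac[symmetric])
  finally have "quat (?r * c) (?r *\<^sub>R (z \<times> x)) ** quat 0 x = quat 0 z ** quat (?r * c) (?r *\<^sub>R (z \<times> x))"
    unfolding quat_scaleR .
  moreover have "(?r * c)\<^sup>2 + (?r *\<^sub>R (z \<times> x)) \<bullet> (?r *\<^sub>R (z \<times> x)) = 1"
    using r by (simp add: N_def power2_eq_square distrib_left mult.assoc mult.left_commute)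
  ultimately show ?thesis by (rule that[rotated])
qed

section \<open>Conjugation of dual quaternions\<close>

lemma dquat_rotation_mult:
  assumes "quat a b ** quat t x = quat t' x' ** quat a b" "quat a b ** quat s y = quat s' y' ** quat a b"
  shows "dquat a b 0 0 ** dquat t x s y = dquat t' x' s' y' ** dquat a b 0 0"
  using assms by (simp add: dquat_def block_mult quat_0)

text \<open>For nonzero \<open>x\<close> the vectors x \<times> d fill the plane orthogonal to
  \<open>x\<close>; for x = 0 they all vanish. This dichotomy separates the two kinds of
  labels.\<close>

lemma dquat_translation_conj:
  "dquat 1 0 0 d ** dquat t x s y = dquat t x s (y + 2 *\<^sub>R (x \<times> d)) ** dquat 1 0 0 d"
  unfolding dquat_mult dquat_eq_iff
  by (simp add: inner_commute cross_skew[of d x] scaleR_2 algebra_simps)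

text \<open>The inverse of the unit dual quaternion \<open>dquat a b c d\<close> is \<open>dquat a (- b) c (- d)\<close>.\<close>

lemma dquat_conj_scalar_parts:
  assumes H: "dquat a b c d \<in> carrier ISU2"
    and eq: "dquat a b c d ** dquat t x s y = dquat t' x' s' y' ** dquat a b c d"
  shows "t' = t \<and> s' = s"
proof -
  have n: "a * a + b \<bullet> b = 1" "a * c + b \<bullet> d = 0"
    using H by (auto simp: dquat_in_carrier power2_eq_square)
  have inv: "dquat a b c d ** dquat a (- b) c (- d) = mat 1"
    unfolding dquat_mult dquat_1[symmetric] dquat_eq_iff
    using n cross_skew[of b d] by (simp add: inner_commute mult.commute)
  have "dquat t' x' s' y' = dquat a b c d ** dquat t x s y ** dquat a (- b) c (- d)"
    unfolding eq by (simp add: inv flip: matrix_mul_assoc)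
  then have t': "t' = t * (a * a + b \<bullet> b)"
    and s': "s' = 2 * t * (a * c + b \<bullet> d) + s * (a * a + b \<bullet> b)
      - ((b \<times> x) \<bullet> d + (d \<times> x) \<bullet> b)"
    unfolding dquat_mult dquat_eq_iff
    by (simp_all add: inner_add_left inner_diff_left dot_cross_self inner_commute algebra_simps)
  \<comment> \<open>The two triple products differ by exchanging \<open>b\<close> and
    \<open>d\<close>, so they are opposite.\<close>
  have "(b \<times> x) \<bullet> d + (d \<times> x) \<bullet> b = 0"
    by (simp add: cross3_simps)
  then show ?thesis using t' s' n by simp
qed

text \<open>For sufficiency with nonzero \<open>x\<close>, a rotation carries \<open>x\<close> to
  \<open>x'\<close>, and then a translation corrects the vector \<open>y\<close>: both vectors have
  the same component along \<open>x'\<close> by the group condition. For x = 0 a rotation of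
  \<open>y\<close> is all that is needed.\<close>

lemma conjugacy_class_dquat_eq_iff:
  assumes M: "dquat t x s y \<in> ISU2_generic" and M': "dquat t' x' s' y' \<in> ISU2_generic"
  shows "conjugacy_class ISU2 (dquat t x s y) = conjugacy_class ISU2 (dquat t' x' s' y') \<longleftrightarrow>
    t = t' \<and> s = s' \<and> (x = 0 \<longrightarrow> norm y = norm y')"
proof -
  note n = M[unfolded dquat_in_generic] M'[unfolded dquat_in_generic]
  have carrier: "dquat t x s y \<in> carrier ISU2" "dquat t' x' s' y' \<in> carrier ISU2"
    using M M' by (auto simp: ISU2_generic_iff)
  have t1: "t = 1" if "x = 0"
    using n(1) that power2_eq_1_iff by auto
  show ?thesis
  proof
    assume "conjugacy_class ISU2 (dquat t x s y) = conjugacy_class ISU2 (dquat t' x' s' y')"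
    then obtain a b c d where H: "dquat a b c d \<in> carrier ISU2"
      and eq: "dquat a b c d ** dquat t x s y = dquat t' x' s' y' ** dquat a b c d"
      unfolding conjugacy_class_ISU2_eq_iff[OF carrier] carrier_ISU2_dquat by blast
    have ts: "t = t'" "s = s'" using dquat_conj_scalar_parts[OF H eq] by auto
    have "norm y = norm y'" if x: "x = 0"
    proof -
      have "t = 1" "t' = 1" "x' = 0" "s = 0" "s' = 0"
        using t1[OF x] ts n x by auto
      then have "quat a b ** quat 0 y = quat 0 y' ** quat a b"
        using eq x unfolding dquat_mult dquat_eq_iff quat_mult quat_eq_iff by simp
      \<comment> \<open>The determinant of \<open>quat 0 y\<close> is the squared length of
        \<open>y\<close>, so multiplicativity of \<open>det\<close> shows that conjugation preserves
        it.\<close>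
      then have "det (quat a b) * det (quat 0 y) = det (quat 0 y') * det (quat a b)"
        by (metis det_mul)
      moreover have "det (quat a b) = 1"
        using H unfolding det_quat dquat_in_carrier by simp
      ultimately have "y \<bullet> y = y' \<bullet> y'"
        by (simp add: det_quat)
      then show ?thesis by (simp add: norm_eq)
    qed
    with ts show "t = t' \<and> s = s' \<and> (x = 0 \<longrightarrow> norm y = norm y')" by blast
  next
    assume R: "t = t' \<and> s = s' \<and> (x = 0 \<longrightarrow> norm y = norm y')"
    have xx: "x \<bullet> x = x' \<bullet> x'"
    proof -
      have "x \<bullet> x = 1 - t\<^sup>2" using conjunct1[OF n(1)] by linarith
      moreover have "x' \<bullet> x' = 1 - t'\<^sup>2" using conjunct1[OF n(2)] by linarith
      ultimately show ?thesis using R by simp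
    qed
    show "conjugacy_class ISU2 (dquat t x s y) = conjugacy_class ISU2 (dquat t' x' s' y')"
    proof (cases "x = 0")
      case True
      then have x': "x' = 0" using xx by simp
      have t: "t = 1" "t' = 1" using t1[OF True] R by simp_all
      have s: "s = 0" "s' = 0" using n t True x' by simp_all
      have "y \<bullet> y = y' \<bullet> y'" using R True by (simp add: norm_eq)
      then obtain a b where ab: "a\<^sup>2 + b \<bullet> b = 1" "quat a b ** quat 0 y = quat 0 y' ** quat a b"
        by (rule quat_conj_transitive)
      have "dquat a b 0 0 ** dquat t x s y = dquat t' x' s' y' ** dquat a b 0 0"
        unfolding s t True x' by (intro dquat_rotation_mult ab(2)) (simp add: quat_1)
      moreover have "dquat a b 0 0 \<in> carrier ISU2" using ab(1) by (simp add: dquat_in_carrier)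
      ultimately show ?thesis unfolding conjugacy_class_ISU2_eq_iff[OF carrier] by blast
    next
      case False
      obtain a b where ab: "a\<^sup>2 + b \<bullet> b = 1" "quat a b ** quat 0 x = quat 0 x' ** quat a b"
        using quat_conj_transitive[OF xx] .
      obtain z where z: "quat a b ** quat 0 y = quat 0 z ** quat a b"
        using quat_conj_vector[OF ab(1)] .
      have H: "dquat a b 0 0 \<in> carrier ISU2" using ab(1) by (simp add: dquat_in_carrier)
      have eq: "dquat a b 0 0 ** dquat t x s y = dquat t x' s z ** dquat a b 0 0"
        by (rule dquat_rotation_mult[OF quat_conj_scalar[OF ab(2)] quat_conj_scalar[OF z]])
      \<comment> \<open>Closure of the group under conjugation; it supplies the inner product of
        \<open>x'\<close> and \<open>z\<close>.\<close>
      have car: "dquat t x' s z \<in> carrier ISU2"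
      proof -
        obtain K where K: "dquat a b 0 0 ** K = mat 1" "K \<in> carrier ISU2"
          using group.r_inv[OF group_ISU2 H] group.inv_closed[OF group_ISU2 H] that
          by (simp add: ISU2_def)
        have "dquat t x' s z = dquat a b 0 0 ** dquat t x s y ** K"
          unfolding eq by (simp add: K flip: matrix_mul_assoc)
        moreover have "A ** B \<in> carrier ISU2" if "A \<in> carrier ISU2" "B \<in> carrier ISU2" for A B
          using group.is_monoid[OF group_ISU2, THEN monoid.m_closed, OF that] by (simp add: ISU2_def)
        ultimately show ?thesis using H K carrier by metis
      qed
      have 1: "conjugacy_class ISU2 (dquat t x s y) = conjugacy_class ISU2 (dquat t x' s z)"
        unfolding conjugacy_class_ISU2_eq_iff[OF carrier(1) car] using H eq by blast
      have x'0: "x' \<bullet> x' \<noteq> 0" using False xx by auto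
      have "t * s + x' \<bullet> z = 0" "t * s + x' \<bullet> y' = 0"
        using car carrier(2) R unfolding dquat_in_carrier by metis+
      then have "x' \<bullet> z = x' \<bullet> y'" by linarith
      then have orth: "x' \<bullet> (y' - z) = 0" by (simp add: inner_diff_right)
      \<comment> \<open>By Lagrange's formula x' \<times> (v \<times> x') is v times the squared
        length of \<open>x'\<close> for v orthogonal to \<open>x'\<close>. The constant also absorbs
        the 2 of \<open>dquat_translation_conj\<close>.\<close>
      define d where "d = (1 / (2 * (x' \<bullet> x'))) *\<^sub>R ((y' - z) \<times> x')"
      have "2 *\<^sub>R (x' \<times> d) = y' - z"
        using x'0 orth by (simp add: d_def cross_mult_right Lagrange)
      then have "dquat 1 0 0 d ** dquat t x' s z = dquat t' x' s' y' ** dquat 1 0 0 d"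
        using dquat_translation_conj[of d t x' s z] R by simp
      moreover have "dquat 1 0 0 d \<in> carrier ISU2" by (simp add: dquat_in_carrier)
      ultimately have "conjugacy_class ISU2 (dquat t x' s z) = conjugacy_class ISU2 (dquat t' x' s' y')"
        unfolding conjugacy_class_ISU2_eq_iff[OF car carrier(2)] by blast
      with 1 show ?thesis by simp
    qed
  qed
qed

subsection \<open>Labels of conjugacy classes\<close>

text \<open>The half angle lies in [0, pi), where cos is injective, so \<open>t\<close> determines
  \<open>r1\<close> and t = 1 singles out the translations. For positive \<open>r1\<close> the
  factor sin (r1 / 2) is nonzero and \<open>s\<close> determines \<open>r2\<close>; for r1 = 0 the
  invariant is r2 / 2.\<close>

lemma conjugacy_class_isu2_exp_eq_iff:
  assumes "norm \<Theta> < 2 * pi" "norm \<Theta>' < 2 * pi"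
  shows "conjugacy_class ISU2 (isu2_exp \<Theta> X) = conjugacy_class ISU2 (isu2_exp \<Theta>' X') \<longleftrightarrow>
    (r1 \<Theta>, r2 \<Theta> X) = (r1 \<Theta>', r2 \<Theta>' X')"
proof -
  have gen: "isu2_exp \<Theta> X \<in> ISU2_generic" "isu2_exp \<Theta>' X' \<in> ISU2_generic"
    using assms isu2_exp_image by blast+
  have cos1: "cos (norm \<Theta> / 2) \<noteq> 1" if "\<Theta> \<noteq> 0" "norm \<Theta> < 2 * pi" for \<Theta> :: "real^3"
    using that cos_monotone_0_pi[of 0 "norm \<Theta> / 2"] by simp
  consider "\<Theta> = 0" "\<Theta>' = 0" | "\<Theta> = 0" "\<Theta>' \<noteq> 0" | "\<Theta> \<noteq> 0" "\<Theta>' = 0" | "\<Theta> \<noteq> 0" "\<Theta>' \<noteq> 0"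
    by blast
  then show ?thesis
  proof cases
    case 1
    then show ?thesis
      using gen by (simp add: isu2_exp_0 conjugacy_class_dquat_eq_iff r1_def r2_def)
  next
    case 2
    obtain n y where e: "isu2_exp \<Theta>' X' = dquat (cos (norm \<Theta>' / 2)) (sin (norm \<Theta>' / 2) *\<^sub>R n)
       (- (\<Theta>' \<bullet> X' / (2 * norm \<Theta>') * sin (norm \<Theta>' / 2))) y"
      using isu2_exp_dquatE[OF 2(2)] .
    show ?thesis
      using gen cos1[OF 2(2) assms(2)] 2
      unfolding e by (simp add: isu2_exp_0 conjugacy_class_dquat_eq_iff r1_def)
  next
    case 3
    obtain n y where e: "isu2_exp \<Theta> X = dquat (cos (norm \<Theta> / 2)) (sin (norm \<Theta> / 2) *\<^sub>R n)
       (- (\<Theta> \<bullet> X / (2 * norm \<Theta>) * sin (norm \<Theta> / 2))) y"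
      using isu2_exp_dquatE[OF 3(1)] .
    show ?thesis
      using gen cos1[OF 3(1) assms(1)] 3
      unfolding e by (simp add: isu2_exp_0 conjugacy_class_dquat_eq_iff r1_def)
  next
    case 4
    obtain n y where n: "n \<bullet> n = 1" and e: "isu2_exp \<Theta> X = dquat (cos (norm \<Theta> / 2)) (sin (norm \<Theta> / 2) *\<^sub>R n)
       (- (\<Theta> \<bullet> X / (2 * norm \<Theta>) * sin (norm \<Theta> / 2))) y"
      using isu2_exp_dquatE[OF 4(1)] .
    obtain n' y' where e': "isu2_exp \<Theta>' X' = dquat (cos (norm \<Theta>' / 2)) (sin (norm \<Theta>' / 2) *\<^sub>R n')
       (- (\<Theta>' \<bullet> X' / (2 * norm \<Theta>') * sin (norm \<Theta>' / 2))) y'"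
      using isu2_exp_dquatE[OF 4(2)] .
    have sin: "sin (norm \<Theta> / 2) \<noteq> 0"
      using 4 assms sin_gt_zero[of "norm \<Theta> / 2"] by simp
    have cos: "cos (norm \<Theta> / 2) = cos (norm \<Theta>' / 2) \<longleftrightarrow> norm \<Theta> = norm \<Theta>'"
      using assms cos_inj_pi[of "norm \<Theta> / 2" "norm \<Theta>' / 2"] by auto
    have "n \<noteq> 0" using n by auto
    then show ?thesis
      using gen sin 4 unfolding e e' conjugacy_class_dquat_eq_iff[OF gen[unfolded e e']] cos
      by (auto simp: r1_def r2_def)
  qed
qed

text \<open>In this form it is visible that no label lies to the left of a point (0, b).\<close>

lemma labels_eq: "labels = {(a, b). (a = 0 \<and> 0 \<le> b) \<or> (0 < a \<and> a < 2 * pi)}"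
proof (intro subset_antisym subsetI)
  fix p assume "p \<in> labels"
  then show "p \<in> {(a, b). (a = 0 \<and> 0 \<le> b) \<or> (0 < a \<and> a < 2 * pi)}"
    by (auto simp: labels_def r1_def r2_def)
next
  fix p :: "real \<times> real" assume "p \<in> {(a, b). (a = 0 \<and> 0 \<le> b) \<or> (0 < a \<and> a < 2 * pi)}"
  then consider b where "p = (0, b)" "0 \<le> b" | a b where "p = (a, b)" "0 < a" "a < 2 * pi"
    by auto
  then show "p \<in> labels"
  proof cases
    case 1
    then have "p = (r1 0, r2 0 (b *\<^sub>R axis 1 1)) \<and> norm (0 :: real^3) < 2 * pi"
      by (simp add: r1_def r2_def)
    then show ?thesis unfolding labels_def by blast
  next
    case 2
    have "axis 1 1 \<bullet> (axis 1 1 :: real^3) = 1" by (simp add: inner_axis_axis)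
    then have "p = (r1 (a *\<^sub>R axis 1 1), r2 (a *\<^sub>R axis 1 1) ((b / a) *\<^sub>R axis 1 1)) \<and>
        norm (a *\<^sub>R axis 1 1 :: real^3) < 2 * pi"
      using 2 by (simp add: r1_def r2_def)
    then show ?thesis unfolding labels_def by blast
  qed
qed

subsection \<open>Topology of the group\<close>

lemma continuous_on_dquat [continuous_intros]:
  assumes "continuous_on S t" "continuous_on S x" "continuous_on S s" "continuous_on S y"
  shows "continuous_on S (\<lambda>v. dquat (t v) (x v) (s v) (y v))"
proof -
  have q: "continuous_on S (\<lambda>v. quat (t v) (x v) $ a $ b)"
    if "continuous_on S t" "continuous_on S x" for t x a b
    using exhaust_2[of a] exhaust_2[of b] that
    by (elim disjE) (simp_all add: quat_components continuous_on_Complex continuous_on_component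
        continuous_on_minus)
  show ?thesis
    unfolding dquat_def block_def
  proof (intro continuous_on_vec_lambda)
    fix i j :: "2 + 2"
    show "continuous_on S (\<lambda>v. case i of
        Inl a \<Rightarrow> (case j of Inl b \<Rightarrow> quat (t v) (x v) $ a $ b | Inr b \<Rightarrow> quat (s v) (y v) $ a $ b)
      | Inr a \<Rightarrow> (case j of Inl b \<Rightarrow> 0 $ a $ b | Inr b \<Rightarrow> quat (t v) (x v) $ a $ b))"
      using q assms by (cases i; cases j) simp_all
  qed
qed

text \<open>Half the real part of the trace of a block. Being defined on all matrices, it is
  continuous on the whole ambient space.\<close>

definition scalar_part :: "isu2_mat \<Rightarrow> real" where
  "scalar_part M = (Re (M $ Inl 1 $ Inl 1) + Re (M $ Inl 2 $ Inl 2)) / 2"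

definition dual_scalar_part :: "isu2_mat \<Rightarrow> real" where
  "dual_scalar_part M = (Re (M $ Inl 1 $ Inr 1) + Re (M $ Inl 2 $ Inr 2)) / 2"

lemma scalar_part_dquat [simp]:
  "scalar_part (dquat t x s y) = t" "dual_scalar_part (dquat t x s y) = s"
  by (simp_all add: scalar_part_def dual_scalar_part_def dquat_def block_def quat_components)

lemma continuous_on_scalar_part [continuous_intros]:
  "continuous_on S scalar_part" "continuous_on S dual_scalar_part"
  unfolding scalar_part_def dual_scalar_part_def by (intro continuous_intros; simp)+

lemma tendsto_at_right_of_continuous:
  fixes f :: "real \<Rightarrow> 'a::topological_space"
  assumes "continuous_on UNIV f"
  shows "(f \<longlongrightarrow> f a) (at_right a)"
  using assms tendsto_mono[OF at_le[OF subset_UNIV]] unfolding continuous_on_def by blast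

lemma openin_ISU2_generic: "openin (top_of_set (carrier ISU2)) ISU2_generic"
proof -
  have "ISU2_generic = carrier ISU2 \<inter> {M. scalar_part M \<noteq> - 1}"
  proof (rule Set.set_eqI)
    fix M
    show "M \<in> ISU2_generic \<longleftrightarrow> M \<in> carrier ISU2 \<inter> {M. scalar_part M \<noteq> - 1}"
    proof (cases "M \<in> carrier ISU2")
      case True
      then obtain t x s y where M: "M = dquat t x s y" unfolding carrier_ISU2_dquat by blast
      from True show ?thesis unfolding M by (simp add: dquat_in_carrier dquat_in_generic)
    qed (simp add: ISU2_generic_iff)
  qed
  moreover have "open {M. scalar_part M \<noteq> - 1}"
    by (intro open_Collect_neq continuous_intros)
  ultimately show ?thesis by (auto simp: openin_open)
qed

lemma carrier_ISU2_subset_closure: "carrier ISU2 \<subseteq> closure ISU2_generic"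
proof
  fix M assume M_in: "M \<in> carrier ISU2"
  show "M \<in> closure ISU2_generic"
  proof (cases "M \<in> ISU2_generic")
    case False
    obtain t x s y where M: "M = dquat t x s y" using M_in unfolding carrier_ISU2_dquat by blast
    have t: "t = - 1" using False M_in unfolding M dquat_in_carrier dquat_in_generic by blast
    moreover have x: "x = 0" using M_in t unfolding M dquat_in_carrier by simp
    ultimately have s: "s = 0" using M_in unfolding M dquat_in_carrier by simp
    \<comment> \<open>The rotation part -1 is perturbed along an axis orthogonal to
      \<open>y\<close>, so the group condition still holds with s = 0 and \<open>y\<close>
      unchanged.\<close>
    obtain n :: "real^3" where n: "n \<noteq> 0" "y \<bullet> n = 0"
      using orthogonal_to_vector_exists[of y] by (auto simp: orthogonal_def)
    let ?n = "(1 / norm n) *\<^sub>R n"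
    have nn: "?n \<bullet> ?n = 1" "?n \<bullet> y = 0"
      using n by (simp_all add: dot_square_norm power2_eq_square inner_commute)
    define f where "f h = dquat (- cos h) (sin h *\<^sub>R ?n) 0 y" for h
    have "continuous_on UNIV f" unfolding f_def by (intro continuous_intros)
    then have "(f \<longlongrightarrow> f 0) (at_right 0)" by (rule tendsto_at_right_of_continuous)
    moreover have "f 0 = M" by (simp add: f_def M t x s)
    ultimately have lim: "(f \<longlongrightarrow> M) (at_right 0)" by simp
    have "\<forall>\<^sub>F h in at_right 0. f h \<in> ISU2_generic"
    proof (rule eventually_at_rightI[of 0 pi])
      fix h :: real assume "h \<in> {0<..<pi}"
      then have "cos h \<noteq> 1" using cos_monotone_0_pi[of 0 h] by simp
      then show "f h \<in> ISU2_generic"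
        unfolding f_def dquat_in_generic using nn by (simp flip: power2_eq_square)
    qed simp
    then have "\<forall>\<^sub>F h in at_right 0. f h \<in> closure ISU2_generic"
      by (rule eventually_mono) (use closure_subset in blast)
    then show ?thesis
      using lim by (rule Lim_in_closed_set[OF closed_closure _ trivial_limit_at_right_real])
  qed (use closure_subset in blast)
qed

subsection \<open>Topology of the space of classes\<close>

lemma quotient_map_class_space:
  "quotient_map (top_of_set ISU2_generic) class_space (conjugacy_class ISU2)"
  unfolding class_space_def by (rule quotient_map_quotient_topology)

lemma topspace_class_space: "topspace class_space = generic_classes"
  by (simp add: class_space_def topspace_quotient_topology generic_classes_def)

text \<open>Continuity of the quotient map along a filter: limits of generic elements turn into
  statements about neighbourhoods of classes.\<close>

lemma eventually_conjugacy_class_in: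
  assumes lim: "(f \<longlongrightarrow> M) F" and M: "M \<in> ISU2_generic"
    and gen: "\<forall>\<^sub>F h in F. f h \<in> ISU2_generic"
    and W: "openin class_space W" "conjugacy_class ISU2 M \<in> W"
  shows "\<forall>\<^sub>F h in F. conjugacy_class ISU2 (f h) \<in> W"
proof -
  have "openin (top_of_set ISU2_generic) {N \<in> ISU2_generic. conjugacy_class ISU2 N \<in> W}"
    using W(1) by (simp add: class_space_def openin_quotient_topology)
  then obtain T where T: "open T" "{N \<in> ISU2_generic. conjugacy_class ISU2 N \<in> W} = ISU2_generic \<inter> T"
    by (auto simp: openin_open)
  then have "M \<in> T" using M W(2) by blast
  then have "\<forall>\<^sub>F h in F. f h \<in> T" using lim T(1) topological_tendstoD by blast
  then show ?thesis
    using gen by eventually_elim (use T(2) in blast)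
qed

text \<open>One chart serves all classes with nonzero rotation: (t, s) is constant on classes and
  continuous, and its continuous section \<open>\<sigma>\<close> provides the inverse.\<close>

lemma locally_planar_at_class:
  assumes M: "dquat t x s y \<in> ISU2_generic" and x: "x \<noteq> 0"
  shows "locally_planar_at class_space (conjugacy_class ISU2 (dquat t x s y))"
proof -
  let ?cl = "conjugacy_class ISU2"
  define V where "V = {v :: real^2. - 1 < v $ 1 \<and> v $ 1 < 1}"
  define W where "W = {N \<in> ISU2_generic. scalar_part N < 1}"
  define U where "U = ?cl ` W"
  define coord where "coord N = (\<chi> i :: 2. if i = 1 then scalar_part N else dual_scalar_part N)" for N
  define e :: "real^3" where "e = axis 3 1"
  \<comment> \<open>A representative with both vectors along the fixed axis \<open>e\<close>: the
    length of the first and the coefficient of the second are forced by the group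
    conditions.\<close>
  define \<sigma> where "\<sigma> v = dquat (v $ 1) (sqrt (1 - (v $ 1)\<^sup>2) *\<^sub>R e) (v $ 2)
      ((- (v $ 1 * v $ 2) / sqrt (1 - (v $ 1)\<^sup>2)) *\<^sub>R e)" for v :: "real^2"
  have ee: "e \<bullet> e = 1" by (simp add: e_def inner_axis_axis)
  have coord_class: "coord N = coord N'"
    if gen: "N \<in> ISU2_generic" "N' \<in> ISU2_generic" and eq: "?cl N = ?cl N'" for N N'
  proof -
    obtain t x s y where N: "N = dquat t x s y" using gen(1) by (rule ISU2_genericE)
    obtain t' x' s' y' where N': "N' = dquat t' x' s' y'" using gen(2) by (rule ISU2_genericE)
    have "t = t' \<and> s = s'"
      using eq conjugacy_class_dquat_eq_iff[OF gen[unfolded N N']] unfolding N N' by blast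
    then show ?thesis by (simp add: coord_def N N' vec_eq_iff forall_2)
  qed
  have scal: "scalar_part N = coord N $ 1" for N by (simp add: coord_def)
  \<comment> \<open>\<open>W\<close> is a union of generic classes, so the quotient map restricts to
    a quotient map on it.\<close>
  have pre: "{N \<in> ISU2_generic. ?cl N \<in> U} = W"
  proof (intro subset_antisym subsetI)
    fix N assume "N \<in> {N \<in> ISU2_generic. ?cl N \<in> U}"
    then obtain N' where N: "N \<in> ISU2_generic" "N' \<in> W" "?cl N = ?cl N'" by (auto simp: U_def)
    then have "coord N = coord N'" using coord_class[of N N'] by (simp add: W_def)
    then show "N \<in> W" using N by (simp add: W_def scal)
  qed (auto simp: U_def W_def)
  have less1: "a\<^sup>2 < 1 \<longleftrightarrow> - 1 < a \<and> a < 1" for a :: real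
    unfolding abs_square_less_1 abs_less_iff by linarith
  have W_iff: "dquat t x s y \<in> W \<longleftrightarrow> dquat t x s y \<in> ISU2_generic \<and> x \<noteq> 0" for t x s y
  proof -
    have "t < 1 \<longleftrightarrow> x \<noteq> 0" if "t\<^sup>2 + x \<bullet> x = 1" "t \<noteq> - 1"
    proof -
      have "x \<noteq> 0 \<longleftrightarrow> t\<^sup>2 < 1" using that(1) inner_gt_zero_iff[of x] by linarith
      moreover have "\<bar>t\<bar> \<le> 1"
        using that(1) inner_ge_zero[of x] unfolding abs_square_le_1[symmetric] by linarith
      ultimately show ?thesis using that(2) unfolding less1 by linarith
    qed
    then show ?thesis unfolding W_def by (auto simp: dquat_in_generic)
  qed
  have W_open: "openin (top_of_set ISU2_generic) W"
  proof -
    have "open {N. scalar_part N < 1}" by (intro open_Collect_less continuous_intros)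
    moreover have "W = ISU2_generic \<inter> {N. scalar_part N < 1}" by (auto simp: W_def)
    ultimately show ?thesis by (auto simp: openin_open)
  qed
  have U_open: "openin class_space U"
  proof -
    have "U \<subseteq> ?cl ` ISU2_generic" by (auto simp: U_def W_def)
    then show ?thesis
      unfolding class_space_def openin_quotient_topology by (simp add: pre W_open)
  qed
  have "quotient_map (subtopology (top_of_set ISU2_generic) W) (subtopology class_space U) ?cl"
    using quotient_map_class_space by (rule quotient_map_restriction) (simp_all add: pre U_open)
  moreover have "ISU2_generic \<inter> W = W" by (auto simp: W_def)
  ultimately have quot: "quotient_map (top_of_set W) (subtopology class_space U) ?cl"
    by (simp add: subtopology_subtopology)
  \<comment> \<open>A choice of representative, harmless by \<open>coord_class\<close>.\<close>
  define f where "f C = coord (SOME N. N \<in> ISU2_generic \<and> ?cl N = C)" for C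
  have f_cl: "f (?cl N) = coord N" if "N \<in> W" for N
  proof -
    have N: "N \<in> ISU2_generic" using that by (simp add: W_def)
    show ?thesis
      unfolding f_def
    proof (rule someI2)
      show "N \<in> ISU2_generic \<and> ?cl N = ?cl N" using N by simp
      show "coord N' = coord N" if "N' \<in> ISU2_generic \<and> ?cl N' = ?cl N" for N'
        using that N coord_class by blast
    qed
  qed
  have coord_V: "coord N \<in> V" if N: "N \<in> W" for N
  proof -
    have "N \<in> ISU2_generic" using N by (simp add: W_def)
    then obtain t x s y where Nd: "N = dquat t x s y" "t\<^sup>2 + x \<bullet> x = 1"
      by (rule ISU2_genericE)
    then have "x \<noteq> 0" using N W_iff by blast
    then have "t\<^sup>2 < 1" using Nd inner_gt_zero_iff[of x] by linarith
    then show ?thesis by (simp add: Nd V_def coord_def less1)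
  qed
  have \<sigma>_W: "\<sigma> v \<in> W" and coord_\<sigma>: "coord (\<sigma> v) = v" if "v \<in> V" for v
  proof -
    have "(v $ 1)\<^sup>2 < 1" using that by (simp add: V_def less1)
    then have p: "sqrt (1 - (v $ 1)\<^sup>2) > 0" by simp
    then have "(sqrt (1 - (v $ 1)\<^sup>2))\<^sup>2 = 1 - (v $ 1)\<^sup>2" by simp
    then have "\<sigma> v \<in> ISU2_generic"
      unfolding \<sigma>_def dquat_in_generic using p that ee
      by (simp add: V_def flip: power2_eq_square)
    moreover have "e \<noteq> 0" using ee by auto
    ultimately show "\<sigma> v \<in> W" unfolding \<sigma>_def W_iff using p by simp
    show "coord (\<sigma> v) = v" by (simp add: \<sigma>_def coord_def vec_eq_iff forall_2)
  qed
  have class_coord: "?cl (\<sigma> (coord N)) = ?cl N" if N: "N \<in> W" for N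
  proof -
    have gen: "N \<in> ISU2_generic" "\<sigma> (coord N) \<in> ISU2_generic"
      using N \<sigma>_W[OF coord_V[OF N]] by (simp_all add: W_def)
    obtain t x s y where Nd: "N = dquat t x s y" using gen(1) by (rule ISU2_genericE)
    have "x \<noteq> 0" using N unfolding Nd W_iff by blast
    moreover have "coord N $ 1 = t" "coord N $ 2 = s" by (simp_all add: coord_def Nd)
    ultimately have "?cl N = ?cl (\<sigma> (coord N))"
      using gen unfolding \<sigma>_def Nd by (simp add: conjugacy_class_dquat_eq_iff)
    then show ?thesis ..
  qed
  have "continuous_on W coord"
    unfolding coord_def
  proof (rule continuous_on_vec_lambda)
    show "continuous_on W (\<lambda>N. if i = 1 then scalar_part N else dual_scalar_part N)" for i :: 2
      by (cases "i = 1") (simp_all add: continuous_on_scalar_part)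
  qed
  then have "continuous_map (top_of_set W) (top_of_set V) coord"
    using coord_V by auto
  then have "continuous_map (top_of_set W) (top_of_set V) (f \<circ> ?cl)"
    by (rule continuous_map_eq) (simp add: f_cl)
  then have f: "continuous_map (subtopology class_space U) (top_of_set V) f"
    using quot continuous_compose_quotient_map by blast
  have "continuous_on V \<sigma>"
    unfolding \<sigma>_def V_def
    by (intro continuous_intros) (auto simp: power2_eq_1_iff)
  then have "continuous_map (top_of_set V) (top_of_set W) \<sigma>"
    using \<sigma>_W by auto
  then have g: "continuous_map (top_of_set V) (subtopology class_space U) (?cl \<circ> \<sigma>)"
    using quotient_imp_continuous_map[OF quot] continuous_map_compose by blast
  have "homeomorphic_maps (subtopology class_space U) (top_of_set V) f (?cl \<circ> \<sigma>)"
    unfolding homeomorphic_maps_def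
  proof (intro conjI f g ballI)
    fix C assume "C \<in> topspace (subtopology class_space U)"
    then obtain N where "N \<in> W" "C = ?cl N" by (auto simp: U_def)
    then show "(?cl \<circ> \<sigma>) (f C) = C" by (simp add: f_cl class_coord)
  next
    fix v assume "v \<in> topspace (top_of_set V)"
    then show "f ((?cl \<circ> \<sigma>) v) = v" by (simp add: f_cl \<sigma>_W coord_\<sigma>)
  qed
  then have "subtopology class_space U homeomorphic_space top_of_set V"
    by (auto simp: homeomorphic_space_def)
  moreover have "open V"
    unfolding V_def by (intro open_Collect_conj open_Collect_less continuous_intros)
  moreover have "?cl (dquat t x s y) \<in> U"
    using M x W_iff by (auto simp: U_def)
  ultimately show ?thesis
    unfolding locally_planar_at_def using U_open by blast
qed

text \<open>The classes of pure translations of lengths \<open>r \<noteq> r'\<close> have no disjoint neighbourhoods: a small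
  rotation about an axis orthogonal to the translation makes both representatives conjugate.\<close>

lemma not_locally_planar_at_class:
  assumes "y = r *\<^sub>R axis 1 1" "0 \<le> r"
  shows "\<not> locally_planar_at class_space (conjugacy_class ISU2 (dquat 1 0 0 y))"
proof
  let ?cl = "conjugacy_class ISU2"
  define e f :: "real^3" where "e = axis 1 1" and "f = axis 3 1"
  have ef: "norm e = 1" "f \<bullet> f = 1" "f \<bullet> e = 0" "f \<noteq> 0"
    by (auto simp: e_def f_def inner_axis_axis axis_eq_0_iff)
  \<comment> \<open>As \<open>f\<close> is orthogonal to \<open>e\<close>, the group condition holds
    with s = 0 for every \<open>r\<close>. Hence the invariants (cos h, 0) do not involve
    \<open>r\<close> once sin h is nonzero.\<close>
  define E where "E r h = dquat (cos h) (sin h *\<^sub>R f) 0 (r *\<^sub>R e)" for r h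
  have gen: "E r h \<in> ISU2_generic" if "0 \<le> h" "h < pi" for r h
  proof -
    have "cos h \<noteq> - 1" using that cos_monotone_0_pi[of h pi] by simp
    then show ?thesis unfolding E_def dquat_in_generic using ef by (simp flip: power2_eq_square)
  qed
  have cont: "continuous_on UNIV (E r)" "continuous_on UNIV (\<lambda>r. E r h)" for r h
    unfolding E_def by (intro continuous_intros)+
  assume "locally_planar_at class_space (?cl (dquat 1 0 0 y))"
  moreover have "dquat 1 0 0 y = E r 0" by (simp add: E_def e_def assms)
  ultimately obtain U and V :: "(real^2) set" where U: "openin class_space U" "?cl (E r 0) \<in> U"
    and hom: "subtopology class_space U homeomorphic_space top_of_set V"
    unfolding locally_planar_at_def by metis
  have haus: "Hausdorff_space (subtopology class_space U)"
    using homeomorphic_Hausdorff_space[OF hom] Hausdorff_space_euclidean Hausdorff_space_subtopology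
    by blast
  have lim: "((\<lambda>r'. E r' 0) \<longlongrightarrow> E r 0) (at_right r)" "(E r \<longlongrightarrow> E r 0) (at_right 0)" for r
    by (rule tendsto_at_right_of_continuous[OF cont(2)], rule tendsto_at_right_of_continuous[OF cont(1)])
  have "\<forall>\<^sub>F r' in at_right r. ?cl (E r' 0) \<in> U"
    by (rule eventually_conjugacy_class_in[OF lim(1) gen _ U]) (simp_all add: gen)
  then have "\<forall>\<^sub>F r' in at_right r. ?cl (E r' 0) \<in> U \<and> r < r'"
    using eventually_at_right_less by (rule eventually_conj)
  \<comment> \<open>Only \<open>U\<close> is known to be Hausdorff, so the second translation is
    taken close enough to the first for its class to lie in \<open>U\<close> too.\<close>
  then obtain r' where r': "?cl (E r' 0) \<in> U" "r < r'"
    using eventually_happens'[OF trivial_limit_at_right_real] by blast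
  have "?cl (E r 0) \<noteq> ?cl (E r' 0)"
    using gen[of 0 r] gen[of 0 r'] r'(2) assms(2) ef(1) unfolding E_def
    by (simp add: conjugacy_class_dquat_eq_iff)
  moreover have "topspace (subtopology class_space U) = U"
    using openin_subset[OF U(1)] by (simp add: Int_absorb1)
  ultimately have "\<exists>W W'. openin (subtopology class_space U) W \<and> openin (subtopology class_space U) W' \<and>
      ?cl (E r 0) \<in> W \<and> ?cl (E r' 0) \<in> W' \<and> disjnt W W'"
    using haus U(2) r'(1) unfolding Hausdorff_space_def by metis
  then obtain W W' where W: "openin class_space W" "openin class_space W'" "?cl (E r 0) \<in> W"
      "?cl (E r' 0) \<in> W'" "disjnt W W'"
    unfolding openin_open_subtopology[OF U(1)] by blast
  have small: "\<forall>\<^sub>F h in at_right 0. h \<in> {0<..<pi}"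
    by (rule eventually_at_right_real) simp
  have small_gen: "\<forall>\<^sub>F h in at_right 0. E \<rho> h \<in> ISU2_generic" for \<rho>
    using small by (rule eventually_mono) (simp add: gen)
  have "\<forall>\<^sub>F h in at_right 0. ?cl (E r h) \<in> W"
    by (rule eventually_conjugacy_class_in[OF lim(2) gen small_gen W(1,3)]) simp_all
  moreover have "\<forall>\<^sub>F h in at_right 0. ?cl (E r' h) \<in> W'"
    by (rule eventually_conjugacy_class_in[OF lim(2) gen small_gen W(2,4)]) simp_all
  ultimately have "\<forall>\<^sub>F h in at_right 0. h \<in> {0<..<pi} \<and> ?cl (E r h) \<in> W \<and> ?cl (E r' h) \<in> W'"
    using small by (intro eventually_conj)
  then obtain h where "h \<in> {0<..<pi}" and hW: "?cl (E r h) \<in> W" "?cl (E r' h) \<in> W'"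
    using eventually_happens'[OF trivial_limit_at_right_real] by blast
  then have h: "0 < h" "h < pi" by simp_all
  have "sin h \<noteq> 0" using sin_gt_zero[OF h] by simp
  then have "sin h *\<^sub>R f \<noteq> 0" using ef(4) by simp
  moreover have "E r h \<in> ISU2_generic" "E r' h \<in> ISU2_generic" using gen h by simp_all
  ultimately have "?cl (E r h) = ?cl (E r' h)"
    unfolding E_def by (simp only: conjugacy_class_dquat_eq_iff simp_thms)
  then show False using hW W(5) by (auto simp: disjnt_def)
qed

lemma locally_planar_at_class_isu2_exp_iff:
  assumes "norm \<Theta> < 2 * pi"
  shows "locally_planar_at class_space (conjugacy_class ISU2 (isu2_exp \<Theta> X)) \<longleftrightarrow> r1 \<Theta> \<noteq> 0"
proof (cases "\<Theta> = 0")
  case True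
  have "norm (norm X *\<^sub>R axis 1 1 :: real^3) = norm X" by simp
  \<comment> \<open>The class of a translation depends only on its length, so the translation may be
    turned into the first coordinate direction; the 1/2 comes from
    \<open>isu2_exp_0\<close>.\<close>
  then have "conjugacy_class ISU2 (isu2_exp \<Theta> X) =
      conjugacy_class ISU2 (dquat 1 0 0 ((norm X / 2) *\<^sub>R axis 1 1))"
    using True by (simp add: isu2_exp_0 conjugacy_class_dquat_eq_iff dquat_in_generic)
  then show ?thesis using True not_locally_planar_at_class[of _ "norm X / 2"] by (simp add: r1_def)
next
  case False
  obtain n y where n: "n \<bullet> n = 1" and e: "isu2_exp \<Theta> X = dquat (cos (norm \<Theta> / 2)) (sin (norm \<Theta> / 2) *\<^sub>R n)
       (- (\<Theta> \<bullet> X / (2 * norm \<Theta>) * sin (norm \<Theta> / 2))) y"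
    using isu2_exp_dquatE[OF False] .
  have "isu2_exp \<Theta> X \<in> ISU2_generic" using assms isu2_exp_image by blast
  moreover have "sin (norm \<Theta> / 2) *\<^sub>R n \<noteq> 0"
    using n False assms sin_gt_zero[of "norm \<Theta> / 2"] by auto
  ultimately show ?thesis
    using False locally_planar_at_class unfolding e by (simp add: r1_def)
qed

subsection \<open>Topology of the label set\<close>

text \<open>Separation gives no obstruction here. At r1 = 0 a chart would force a neighbourhood
  inside \<open>labels\<close> to be open in the plane; elsewhere the open strip itself is the
  chart.\<close>

lemma locally_planar_at_labels_iff:
  assumes "p \<in> labels"
  shows "locally_planar_at (top_of_set labels) p \<longleftrightarrow> fst p \<noteq> 0"
proof
  assume "locally_planar_at (top_of_set labels) p"
  then obtain U and V :: "(real^2) set" where U: "openin (top_of_set labels) U" "p \<in> U" and V: "open V"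
    and hom: "subtopology (top_of_set labels) U homeomorphic_space top_of_set V"
    unfolding locally_planar_at_def by blast
  have sub: "U \<subseteq> labels" using openin_subset[OF U(1)] by simp
  then have "subtopology (top_of_set labels) U = top_of_set U"
    by (simp add: subtopology_subtopology Int_absorb1)
  then obtain g h where "homeomorphic_maps (top_of_set U) (top_of_set V) h g"
    using hom by (auto simp: homeomorphic_space_def)
  then have g: "continuous_on V g" "g ` V \<subseteq> U" "\<And>v. v \<in> V \<Longrightarrow> h (g v) = v"
      "\<And>u. u \<in> U \<Longrightarrow> h u \<in> V" "\<And>u. u \<in> U \<Longrightarrow> g (h u) = u"
    by (auto simp: homeomorphic_maps_def)
  have "inj_on g V" using g(3) by (metis inj_onI)
  \<comment> \<open>Invariance of domain for \<open>g\<close>, an injective continuous map from an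
    open subset of \<open>real^2\<close> into a space of the same dimension.\<close>
  then have "open (g ` V)"
    using V g(1) by (intro invariance_of_domain_gen) auto
  moreover have "g ` V = U" using g by force
  ultimately have "open U" by simp
  show "fst p \<noteq> 0"
  proof
    assume "fst p = 0"
    \<comment> \<open>Approaching \<open>p\<close> from the left would place points with negative
      first coordinate in the open set \<open>U\<close>, although \<open>U\<close> consists of
      labels.\<close>
    have "((\<lambda>a. (a, snd p)) \<longlongrightarrow> (0, snd p)) (at_left 0)"
      by (intro tendsto_intros)
    moreover have "(0, snd p) \<in> U" using U(2) \<open>fst p = 0\<close> by (metis prod.collapse)
    ultimately have "\<forall>\<^sub>F a in at_left 0. (a, snd p) \<in> U"
      using \<open>open U\<close> topological_tendstoD by blast
    moreover have "\<forall>\<^sub>F a in at_left (0::real). a < 0"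
      by (simp add: eventually_at_filter)
    ultimately have "\<forall>\<^sub>F a in at_left (0::real). False"
      by eventually_elim (use sub in \<open>auto simp: labels_eq\<close>)
    then show False by simp
  qed
next
  assume p: "fst p \<noteq> 0"
  define U where "U = {q :: real \<times> real. 0 < fst q \<and> fst q < 2 * pi}"
  define V where "V = {v :: real^2. 0 < v $ 1 \<and> v $ 1 < 2 * pi}"
  define f where "f q = (\<chi> i :: 2. if i = 1 then fst q else snd q)" for q :: "real \<times> real"
  define g where "g v = (v $ 1, v $ 2)" for v :: "real^2"
  have "open U" "open V"
    unfolding U_def V_def by (intro open_Collect_conj open_Collect_less continuous_intros)+
  moreover have "U \<subseteq> labels" "p \<in> U"
    using assms p by (auto simp: U_def labels_eq)
  moreover have "continuous_on U f"
    unfolding f_def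
  proof (rule continuous_on_vec_lambda)
    show "continuous_on U (\<lambda>q. if i = 1 then fst q else snd q)" for i :: 2
      by (cases "i = 1") (simp_all add: continuous_on_fst continuous_on_snd)
  qed
  moreover have "continuous_on V g"
    unfolding g_def by (intro continuous_intros)
  ultimately have "openin (top_of_set labels) U" "homeomorphic_maps (top_of_set U) (top_of_set V) f g"
      "subtopology (top_of_set labels) U = top_of_set U"
    by (auto simp: homeomorphic_maps_def U_def V_def f_def g_def vec_eq_iff forall_2
        subtopology_subtopology Int_absorb1 open_subset)
  then show "locally_planar_at (top_of_set labels) p"
    unfolding locally_planar_at_def homeomorphic_space_def
    using \<open>open V\<close> \<open>p \<in> U\<close> by metis
qed

theorem mainTheorem5:
  shows "{isu2_exp \<Theta> X | \<Theta> X. norm \<Theta> < 2 * pi} = ISU2_generic \<and>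
    openin (top_of_set (carrier ISU2)) ISU2_generic \<and>
    carrier ISU2 \<subseteq> closure ISU2_generic \<and>
    (\<exists>label. bij_betw label generic_classes labels \<and>
      (\<forall>\<Theta> X. norm \<Theta> < 2 * pi \<longrightarrow>
         label (conjugacy_class ISU2 (isu2_exp \<Theta> X)) = (r1 \<Theta>, r2 \<Theta> X)) \<and>
      (\<forall>C\<in>generic_classes. locally_planar_at class_space C \<longleftrightarrow> fst (label C) \<noteq> 0)) \<and>
    (\<forall>p\<in>labels. locally_planar_at (top_of_set labels) p \<longleftrightarrow> fst p \<noteq> 0) \<and>
    \<not> two_manifold class_space \<and>
    \<not> two_manifold (top_of_set labels)"
proof (intro conjI isu2_exp_image openin_ISU2_generic carrier_ISU2_subset_closure ballI
    locally_planar_at_labels_iff)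
  let ?cl = "conjugacy_class ISU2"
  have classE: "\<exists>\<Theta> X. norm \<Theta> < 2 * pi \<and> C = ?cl (isu2_exp \<Theta> X)" if "C \<in> generic_classes" for C
    using that unfolding generic_classes_def isu2_exp_image[symmetric] by blast
  have class_in: "?cl (isu2_exp \<Theta> X) \<in> generic_classes" if "norm \<Theta> < 2 * pi" for \<Theta> X
    using that unfolding generic_classes_def isu2_exp_image[symmetric] by blast
  \<comment> \<open>The choice is unique: by \<open>conjugacy_class_isu2_exp_eq_iff\<close> all
    parameters of one class give the same pair.\<close>
  define label where "label C =
    (SOME p. \<exists>\<Theta> X. norm \<Theta> < 2 * pi \<and> C = ?cl (isu2_exp \<Theta> X) \<and> p = (r1 \<Theta>, r2 \<Theta> X))" for C
  have label: "label (?cl (isu2_exp \<Theta> X)) = (r1 \<Theta>, r2 \<Theta> X)" if "norm \<Theta> < 2 * pi" for \<Theta> X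
    unfolding label_def
    by (rule some_equality) (use that conjugacy_class_isu2_exp_eq_iff in blast)+
  have "bij_betw label generic_classes labels"
    unfolding bij_betw_def
  proof (intro conjI)
    show "inj_on label generic_classes"
    proof (rule inj_onI)
      fix C C' assume C: "C \<in> generic_classes" "C' \<in> generic_classes" and eq: "label C = label C'"
      obtain \<Theta> X where 1: "norm \<Theta> < 2 * pi" "C = ?cl (isu2_exp \<Theta> X)" using classE[OF C(1)] by blast
      obtain \<Theta>' X' where 2: "norm \<Theta>' < 2 * pi" "C' = ?cl (isu2_exp \<Theta>' X')" using classE[OF C(2)] by blast
      have "(r1 \<Theta>, r2 \<Theta> X) = (r1 \<Theta>', r2 \<Theta>' X')"
        using eq unfolding 1(2) 2(2) label[OF 1(1)] label[OF 2(1)] .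
      then show "C = C'"
        unfolding 1(2) 2(2) conjugacy_class_isu2_exp_eq_iff[OF 1(1) 2(1)] .
    qed
    have "label C \<in> labels" if C: "C \<in> generic_classes" for C
    proof -
      obtain \<Theta> X where 1: "norm \<Theta> < 2 * pi" "C = ?cl (isu2_exp \<Theta> X)" using classE[OF C] by blast
      then show ?thesis unfolding 1(2) label[OF 1(1)] labels_def by blast
    qed
    moreover have "p \<in> label ` generic_classes" if p: "p \<in> labels" for p
    proof -
      obtain \<Theta> X where 1: "norm \<Theta> < 2 * pi" "p = (r1 \<Theta>, r2 \<Theta> X)"
        using p unfolding labels_def by blast
      then show ?thesis using label[OF 1(1), of X] class_in[OF 1(1), of X] by (metis imageI)
    qed
    ultimately show "label ` generic_classes = labels" by blast
  qed
  moreover have "locally_planar_at class_space C \<longleftrightarrow> fst (label C) \<noteq> 0" if C: "C \<in> generic_classes" for C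
  proof -
    obtain \<Theta> X where 1: "norm \<Theta> < 2 * pi" "C = ?cl (isu2_exp \<Theta> X)" using classE[OF C] by blast
    show ?thesis
      unfolding 1(2) label[OF 1(1)] locally_planar_at_class_isu2_exp_iff[OF 1(1)] by simp
  qed
  ultimately show "\<exists>label. bij_betw label generic_classes labels \<and>
      (\<forall>\<Theta> X. norm \<Theta> < 2 * pi \<longrightarrow> label (?cl (isu2_exp \<Theta> X)) = (r1 \<Theta>, r2 \<Theta> X)) \<and>
      (\<forall>C\<in>generic_classes. locally_planar_at class_space C \<longleftrightarrow> fst (label C) \<noteq> 0)"
    using label by blast
  have "\<not> locally_planar_at class_space (?cl (isu2_exp 0 0))"
    by (subst locally_planar_at_class_isu2_exp_iff) (simp_all add: r1_def)
  moreover have "?cl (isu2_exp 0 0) \<in> topspace class_space"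
    using class_in[of 0 0] by (simp add: topspace_class_space)
  ultimately show "\<not> two_manifold class_space"
    unfolding two_manifold_def by blast
  have "(0, 0) \<in> labels" by (simp add: labels_eq)
  then show "\<not> two_manifold (top_of_set labels)"
    using locally_planar_at_labels_iff[of "(0, 0)"] unfolding two_manifold_def by auto
qed

end
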